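(* Let $\lambda$ be an ordinal and $X:\lambda\to\mathbf{MdTop}$ a colimit-preserving functor with $X_0=(X^0,X^0,\varnothing)$ a set and, for every $\nu<\lambda$, $X_\nu\to X_{\nu+1}$ a pushout of ${\rm Glob}^{\mathcal{G}}(\mathbf{S}^{n_\nu-1})\subset{\rm Glob}^{\mathcal{G}}(\mathbf{D}^{n_\nu})$ along some map ${\rm Glob}^{\mathcal{G}}(\mathbf{S}^{n_\nu-1})\to X_\nu$, $n_\nu\ge0$. Let $X_\lambda=\varinjlim_{\nu<\lambda}X_\nu$. Then the composite functor $\nu\mapsto\mathbb{P}^{\mathcal{G}}X_\nu$ from $\lambda$ to $\mathbf{Top}$ is colimit-preserving; in particular the continuous bijection $\varinjlim_{\nu<\lambda}\mathbb{P}^{\mathcal{G}}X_\nu\to\mathbb{P}^{\mathcal{G}}X_\lambda$ is a homeomorphism. Moreover, the topology of $\mathbb{P}^{\mathcal{G}}X_\lambda$ is the final topology.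
   Context: Work in $\mathbf{Top}$, the category of $\Delta$-generated spaces (or $\Delta$-Hausdorff $\Delta$-generated spaces), cartesian closed with internal hom ${\rm TOP}$; subsets carry the $\Delta$-kelleyfication of the relative topology. $\mathcal{G}(1,1)$: nondecreasing homeomorphisms of $[0,1]$; $*_N$: normalized composition of paths on $[0,1]$. A multipointed $d$-space $X=(|X|,X^0,\mathbb{P}^{\mathcal{G}}X)$: a space, a subset of states, a set of continuous execution paths $[0,1]\to|X|$ with endpoints in $X^0$, stable under precomposition by $\mathcal{G}(1,1)$ and $*_N$; maps preserve states and paths; category $\mathbf{MdTop}$. $\mathbb{P}^{\mathcal{G}}_{\alpha,\beta}X$ is a subspace of ${\rm TOP}([0,1],|X|)$ and $\mathbb{P}^{\mathcal{G}}X=\bigsqcup_{(\alpha,\beta)\in X^0\times X^0}\mathbb{P}^{\mathcal{G}}_{\alpha,\beta}X$. Colimits in $\mathbf{MdTop}$: underlying spaces and states by colimits, execution paths generated by images under $*_N$ and reparametrization. ${\rm Glob}^{\mathcal{G}}(Z)$: quotient of $\{0,1\}\sqcup Z\times[0,1]$ with $(z,0)\sim0$, $(z,1)\sim1$, states $\{0,1\}$, paths $t\mapsto(z,\phi(t))$, $\phi\in\mathcal{G}(1,1)$; sets $E$ are $(E,E,\varnothing)$. *)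

theory Defs
  imports "HOL-Analysis.Analysis" "HOL-Homology.Simplices"
begin

definition simplex_top :: "nat \<Rightarrow> (nat \<Rightarrow> real) topology" where
  "simplex_top n = subtopology (powertop_real UNIV) (standard_simplex n)"

definition unit_top :: "real topology" where
  "unit_top = top_of_set {0..1}"

definition kdelta :: "'a topology \<Rightarrow> 'a topology" where
  "kdelta X = topology (\<lambda>U. U \<subseteq> topspace X \<and>
     (\<forall>n \<sigma>. continuous_map (simplex_top n) X \<sigma> \<longrightarrow>
        openin (simplex_top n) {x \<in> standard_simplex n. \<sigma> x \<in> U}))"

definition delta_generated :: "'a topology \<Rightarrow> bool" where
  "delta_generated X \<longleftrightarrow> kdelta X = X"

definition dsub :: "'a topology \<Rightarrow> 'a set \<Rightarrow> 'a topology" where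
  "dsub X S = kdelta (subtopology X S)"

definition cpaths :: "'a topology \<Rightarrow> (real \<Rightarrow> 'a) set" where
  "cpaths X = {\<gamma>. \<gamma> \<in> extensional {0..1} \<and> continuous_map unit_top X \<gamma>}"

text \<open>TOP([0,1],X) in Delta-generated spaces: the Delta-generated topology on the set of
  continuous paths whose plots are the maps from simplices with continuous adjoint.\<close>
definition path_top :: "'a topology \<Rightarrow> (real \<Rightarrow> 'a) topology" where
  "path_top X = topology (\<lambda>U. U \<subseteq> cpaths X \<and>
     (\<forall>n (g :: (nat \<Rightarrow> real) \<Rightarrow> real \<Rightarrow> 'a).
        (\<forall>x\<in>standard_simplex n. g x \<in> cpaths X) \<and>
        continuous_map (prod_topology (simplex_top n) unit_top) X (\<lambda>p. g (fst p) (snd p))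
        \<longrightarrow> openin (simplex_top n) {x \<in> standard_simplex n. g x \<in> U}))"

definition reparam :: "(real \<Rightarrow> real) set" where
  "reparam = {\<phi>. homeomorphic_map unit_top unit_top \<phi> \<and> mono_on {0..1} \<phi>}"

definition pmap :: "('a \<Rightarrow> 'b) \<Rightarrow> (real \<Rightarrow> 'a) \<Rightarrow> (real \<Rightarrow> 'b)" where
  "pmap f \<gamma> = restrict (f \<circ> \<gamma>) {0..1}"

definition ncomp :: "(real \<Rightarrow> 'a) \<Rightarrow> (real \<Rightarrow> 'a) \<Rightarrow> (real \<Rightarrow> 'a)" where
  "ncomp \<gamma>1 \<gamma>2 = restrict (\<lambda>t. if t \<le> 1/2 then \<gamma>1 (2*t) else \<gamma>2 (2*t - 1)) {0..1}"

definition path_closed :: "(real \<Rightarrow> 'a) set \<Rightarrow> bool" where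
  "path_closed P \<longleftrightarrow>
     (\<forall>\<gamma>\<in>P. \<forall>\<phi>\<in>reparam. restrict (\<gamma> \<circ> \<phi>) {0..1} \<in> P) \<and>
     (\<forall>\<gamma>1\<in>P. \<forall>\<gamma>2\<in>P. \<gamma>1 1 = \<gamma>2 0 \<longrightarrow> ncomp \<gamma>1 \<gamma>2 \<in> P)"

definition gen_paths :: "(real \<Rightarrow> 'a) set \<Rightarrow> (real \<Rightarrow> 'a) set" where
  "gen_paths S = \<Inter>{P. S \<subseteq> P \<and> path_closed P}"

record 'a mdspace =
  md_top :: "'a topology"
  md_states :: "'a set"
  md_paths :: "(real \<Rightarrow> 'a) set"

definition is_mdspace :: "'a mdspace \<Rightarrow> bool" where
  "is_mdspace X \<longleftrightarrow> delta_generated (md_top X) \<and>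
     md_states X \<subseteq> topspace (md_top X) \<and>
     md_paths X \<subseteq> cpaths (md_top X) \<and>
     (\<forall>\<gamma>\<in>md_paths X. \<gamma> 0 \<in> md_states X \<and> \<gamma> 1 \<in> md_states X) \<and>
     path_closed (md_paths X)"

definition md_map :: "'a mdspace \<Rightarrow> 'b mdspace \<Rightarrow> ('a \<Rightarrow> 'b) \<Rightarrow> bool" where
  "md_map X Y f \<longleftrightarrow> continuous_map (md_top X) (md_top Y) f \<and>
     f ` md_states X \<subseteq> md_states Y \<and> pmap f ` md_paths X \<subseteq> md_paths Y"

definition md_set :: "'a set \<Rightarrow> 'a mdspace" where
  "md_set E = \<lparr>md_top = discrete_topology E, md_states = E, md_paths = {}\<rparr>"

text \<open>The space of execution paths P^G X: disjoint sum of the subspaces P_{a,b} X of TOP([0,1],|X|).\<close>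
definition exec_paths_ab :: "'a mdspace \<Rightarrow> 'a \<Rightarrow> 'a \<Rightarrow> (real \<Rightarrow> 'a) set" where
  "exec_paths_ab X a b = {\<gamma> \<in> md_paths X. \<gamma> 0 = a \<and> \<gamma> 1 = b}"

definition exec_top :: "'a mdspace \<Rightarrow> (real \<Rightarrow> 'a) topology" where
  "exec_top X = topology (\<lambda>U. U \<subseteq> md_paths X \<and>
     (\<forall>a\<in>md_states X. \<forall>b\<in>md_states X.
        openin (dsub (path_top (md_top X)) (exec_paths_ab X a b)) (U \<inter> exec_paths_ab X a b)))"

text \<open>R^n is represented inside nat => real (coordinates >= n vanish).\<close>
definition disk :: "nat \<Rightarrow> (nat \<Rightarrow> real) set" where
  "disk n = {x. (\<forall>i\<ge>n. x i = 0) \<and> (\<Sum>i<n. (x i)\<^sup>2) \<le> 1}"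

text \<open>sphere n is S^{n-1}; in particular sphere 0 is empty.\<close>
definition sphere_m1 :: "nat \<Rightarrow> (nat \<Rightarrow> real) set" where
  "sphere_m1 n = {x. (\<forall>i\<ge>n. x i = 0) \<and> (\<Sum>i<n. (x i)\<^sup>2) = 1}"

type_synonym glob_pt = "bool + ((nat \<Rightarrow> real) \<times> real)"

text \<open>The point of Glob(Z) represented by (z,t): Inl False = 0, Inl True = 1.\<close>
definition glob_pt :: "(nat \<Rightarrow> real) \<Rightarrow> real \<Rightarrow> glob_pt" where
  "glob_pt z t = (if t = 0 then Inl False else if t = 1 then Inl True else Inr (z, t))"

definition glob_carrier :: "(nat \<Rightarrow> real) set \<Rightarrow> glob_pt set" where
  "glob_carrier Z = {Inl False, Inl True} \<union> (\<lambda>p. glob_pt (fst p) (snd p)) ` (Z \<times> {0..1})"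

text \<open>Quotient topology of {0,1} + Z x [0,1] (Delta-kelleyfied).\<close>
definition glob_top :: "(nat \<Rightarrow> real) set \<Rightarrow> glob_pt topology" where
  "glob_top Z = kdelta (topology (\<lambda>U. U \<subseteq> glob_carrier Z \<and>
     openin (prod_topology (top_of_set Z) unit_top)
        {p \<in> Z \<times> {0..1}. glob_pt (fst p) (snd p) \<in> U}))"

definition Glob :: "(nat \<Rightarrow> real) set \<Rightarrow> glob_pt mdspace" where
  "Glob Z = \<lparr>md_top = glob_top Z, md_states = {Inl False, Inl True},
     md_paths = {restrict (\<lambda>t. glob_pt z (\<phi> t)) {0..1} | z \<phi>. z \<in> Z \<and> \<phi> \<in> reparam}\<rparr>"

definition md_colimit ::
  "'i::linorder set \<Rightarrow> ('i \<Rightarrow> 'a mdspace) \<Rightarrow> ('i \<Rightarrow> 'i \<Rightarrow> 'a \<Rightarrow> 'a) \<Rightarrow> 'b mdspace \<Rightarrow> ('i \<Rightarrow> 'a \<Rightarrow> 'b) \<Rightarrow> bool" where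
  "md_colimit I X f Y h \<longleftrightarrow>
     topspace (md_top Y) = (\<Union>i\<in>I. h i ` topspace (md_top (X i))) \<and>
     (\<forall>i\<in>I. \<forall>j\<in>I. \<forall>x\<in>topspace (md_top (X i)). \<forall>y\<in>topspace (md_top (X j)).
        h i x = h j y \<longrightarrow> (\<exists>k\<in>I. i \<le> k \<and> j \<le> k \<and> f i k x = f j k y)) \<and>
     (\<forall>U. openin (md_top Y) U \<longleftrightarrow> U \<subseteq> topspace (md_top Y) \<and>
        (\<forall>i\<in>I. openin (md_top (X i)) {x \<in> topspace (md_top (X i)). h i x \<in> U})) \<and>
     md_states Y = (\<Union>i\<in>I. h i ` md_states (X i)) \<and>
     md_paths Y = gen_paths (\<Union>i\<in>I. pmap (h i) ` md_paths (X i))"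

definition glob_pushout ::
  "nat \<Rightarrow> (glob_pt \<Rightarrow> 'a) \<Rightarrow> 'a mdspace \<Rightarrow> 'a mdspace \<Rightarrow> ('a \<Rightarrow> 'a) \<Rightarrow> (glob_pt \<Rightarrow> 'a) \<Rightarrow> bool" where
  "glob_pushout n g X Y f gh \<longleftrightarrow>
     (let A = glob_carrier (sphere_m1 n); B = glob_carrier (disk n) in
      md_map (Glob (sphere_m1 n)) X g \<and> md_map (Glob (disk n)) Y gh \<and>
      (\<forall>a\<in>A. gh a = f (g a)) \<and>
      inj_on f (topspace (md_top X)) \<and> inj_on gh (B - A) \<and>
      f ` topspace (md_top X) \<inter> gh ` (B - A) = {} \<and>
      topspace (md_top Y) = f ` topspace (md_top X) \<union> gh ` B \<and>
      (\<forall>U. openin (md_top Y) U \<longleftrightarrow> U \<subseteq> topspace (md_top Y) \<and>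
         openin (md_top X) {x \<in> topspace (md_top X). f x \<in> U} \<and>
         openin (glob_top (disk n)) {x \<in> B. gh x \<in> U}) \<and>
      md_states Y = f ` md_states X \<union> gh ` md_states (Glob (disk n)) \<and>
      md_paths Y = gen_paths (pmap f ` md_paths X \<union> pmap gh ` md_paths (Glob (disk n))))"

definition top_colimit ::
  "'i::linorder set \<Rightarrow> ('i \<Rightarrow> 'a topology) \<Rightarrow> ('i \<Rightarrow> 'i \<Rightarrow> 'a \<Rightarrow> 'a) \<Rightarrow> 'b topology \<Rightarrow> ('i \<Rightarrow> 'a \<Rightarrow> 'b) \<Rightarrow> bool" where
  "top_colimit I T f S h \<longleftrightarrow>
     topspace S = (\<Union>i\<in>I. h i ` topspace (T i)) \<and>
     (\<forall>i\<in>I. \<forall>j\<in>I. \<forall>x\<in>topspace (T i). \<forall>y\<in>topspace (T j).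
        h i x = h j y \<longrightarrow> (\<exists>k\<in>I. i \<le> k \<and> j \<le> k \<and> f i k x = f j k y)) \<and>
     (\<forall>U. openin S U \<longleftrightarrow> U \<subseteq> topspace S \<and>
        (\<forall>i\<in>I. openin (T i) {x \<in> topspace (T i). h i x \<in> U}))"

definition is_succ :: "'i::wellorder \<Rightarrow> 'i \<Rightarrow> bool" where
  "is_succ \<nu> \<nu>' \<longleftrightarrow> \<nu> < \<nu>' \<and> (\<forall>\<rho>. \<nu> < \<rho> \<longrightarrow> \<nu>' \<le> \<rho>)"

definition is_limit :: "'i::wellorder \<Rightarrow> bool" where
  "is_limit \<nu> \<longleftrightarrow> (\<exists>\<mu>. \<mu> < \<nu>) \<and> (\<forall>\<mu><\<nu>. \<exists>\<rho>. \<mu> < \<rho> \<and> \<rho> < \<nu>)"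

definition is_least :: "'i::wellorder \<Rightarrow> bool" where
  "is_least \<nu> \<longleftrightarrow> (\<forall>\<mu>. \<not> \<mu> < \<nu>)"

end

theory Submission
  imports Defs
begin

text \<open>
  Write \<open>Y\<close> for the colimit. The boundary globe is \<open>\<Delta>\<close>-generated (the cylinder over a sphere is a
  finite union of images of simplices), so attaching a globe is a closed embedding, and by
  transfinite induction all maps of the tower and of the colimit cocone are closed embeddings.
  They also reflect execution paths: a composite of globe paths that stays in an earlier stage only
  uses globe paths of that stage. As in a cell complex, a compact subset of \<open>Y\<close> lies in one stage.
  A continuous map from a simplex to the path space of \<open>Y\<close> has a continuous adjoint on a compact
  product, hence it factors through the execution paths of one stage, which yields the final
  topology.
\<close>

section \<open>Plots and path spaces\<close>

text \<open>Passing to path spaces does not commute with colimits in general, so knowing the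
  underlying space of the colimit is not enough. What helps is that the topologies on paths are
  determined by their plots: openness is tested on simplices, so it suffices to lift one plot at a
  time, and a plot has a compact domain after adjunction. A lift to a stage uses three properties of
  the map \<open>h i\<close>: injectivity makes it unique, closedness makes it continuous, and
  reflection of execution paths makes its values execution paths of that stage. Each property is
  obtained by an induction on the upper index of the maps \<open>f\<close>, in which a limit stage
  is itself a colimit of the kind under study. The compactness argument appeals to no separation
  axiom on \<open>Y\<close>: the sets that have to be closed are shown to be closed stage by
  stage.\<close>

lemma istopology_plots:
  "istopology (\<lambda>U. U \<subseteq> S \<and> (\<forall>n \<sigma>. P n \<sigma> \<longrightarrow> openin (T n) {x \<in> D n. \<sigma> x \<in> U}))"
  unfolding istopology_def
proof (intro conjI allI impI)
  fix U V n \<sigma>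
  assume "U \<subseteq> S \<and> (\<forall>n \<sigma>. P n \<sigma> \<longrightarrow> openin (T n) {x \<in> D n. \<sigma> x \<in> U})"
    and "V \<subseteq> S \<and> (\<forall>n \<sigma>. P n \<sigma> \<longrightarrow> openin (T n) {x \<in> D n. \<sigma> x \<in> V})" and "P n \<sigma>"
  then have "openin (T n) ({x \<in> D n. \<sigma> x \<in> U} \<inter> {x \<in> D n. \<sigma> x \<in> V})"
    by (intro openin_Int) auto
  also have "{x \<in> D n. \<sigma> x \<in> U} \<inter> {x \<in> D n. \<sigma> x \<in> V} = {x \<in> D n. \<sigma> x \<in> U \<inter> V}"
    by auto
  finally show "openin (T n) {x \<in> D n. \<sigma> x \<in> U \<inter> V}" .
next
  fix K n \<sigma>
  assume "\<forall>U\<in>K. U \<subseteq> S \<and> (\<forall>n \<sigma>. P n \<sigma> \<longrightarrow> openin (T n) {x \<in> D n. \<sigma> x \<in> U})" and "P n \<sigma>"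
  then have "openin (T n) (\<Union>U\<in>K. {x \<in> D n. \<sigma> x \<in> U})"
    by (intro openin_Union) auto
  also have "(\<Union>U\<in>K. {x \<in> D n. \<sigma> x \<in> U}) = {x \<in> D n. \<sigma> x \<in> \<Union>K}"
    by auto
  finally show "openin (T n) {x \<in> D n. \<sigma> x \<in> \<Union>K}" .
qed auto

lemma simplex_top_eq: "simplex_top n = top_of_set (standard_simplex n)"
  by (simp add: simplex_top_def euclidean_product_topology)

lemma topspace_simplex_top [simp]: "topspace (simplex_top n) = standard_simplex n"
  by (simp add: simplex_top_eq)

lemma topspace_unit_top [simp]: "topspace unit_top = {0..1}"
  by (simp add: unit_top_def)

lemma compact_space_simplex_top: "compact_space (simplex_top n)"
  unfolding simplex_top_def by (simp add: compact_space_subtopology compactin_standard_simplex)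

lemma compact_space_unit_top: "compact_space unit_top"
  by (simp add: unit_top_def compact_space_subtopology)

lemma openin_kdelta:
  "openin (kdelta X) U \<longleftrightarrow> U \<subseteq> topspace X \<and>
     (\<forall>n \<sigma>. continuous_map (simplex_top n) X \<sigma> \<longrightarrow>
        openin (simplex_top n) {x \<in> standard_simplex n. \<sigma> x \<in> U})"
  unfolding kdelta_def by (subst topology_inverse') (rule istopology_plots, rule refl)

lemma openin_imp_openin_kdelta: "openin X U \<Longrightarrow> openin (kdelta X) U"
  unfolding openin_kdelta
  using openin_continuous_map_preimage openin_subset by fastforce

lemma topspace_kdelta [simp]: "topspace (kdelta X) = topspace X"
  by (meson openin_imp_openin_kdelta openin_kdelta openin_subset openin_topspace subset_antisym)

lemma closedin_imp_closedin_kdelta: "closedin X C \<Longrightarrow> closedin (kdelta X) C"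
  by (simp add: closedin_def openin_imp_openin_kdelta)

text \<open>Kelleyfication only adds open sets that every simplex already pulls back to open sets,
  so a simplex stays continuous.\<close>

lemma continuous_map_simplex_kdelta:
  "continuous_map (simplex_top n) (kdelta X) \<sigma> \<longleftrightarrow> continuous_map (simplex_top n) X \<sigma>"
proof
  assume "continuous_map (simplex_top n) (kdelta X) \<sigma>"
  then show "continuous_map (simplex_top n) X \<sigma>"
    by (simp add: continuous_map_def openin_imp_openin_kdelta)
next
  assume "continuous_map (simplex_top n) X \<sigma>"
  then show "continuous_map (simplex_top n) (kdelta X) \<sigma>"
    by (simp add: continuous_map_def openin_kdelta)
qed

section \<open>Plots of the path space and continuous adjoints\<close>

definition path_plot :: "nat \<Rightarrow> 'a topology \<Rightarrow> ((nat \<Rightarrow> real) \<Rightarrow> real \<Rightarrow> 'a) \<Rightarrow> bool" where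
  "path_plot n X g \<longleftrightarrow> (\<forall>x\<in>standard_simplex n. g x \<in> cpaths X) \<and>
     continuous_map (prod_topology (simplex_top n) unit_top) X (\<lambda>p. g (fst p) (snd p))"

lemma openin_path_top:
  "openin (path_top X) U \<longleftrightarrow> U \<subseteq> cpaths X \<and>
     (\<forall>n g. path_plot n X g \<longrightarrow> openin (simplex_top n) {x \<in> standard_simplex n. g x \<in> U})"
  unfolding path_top_def path_plot_def
  by (subst topology_inverse') (rule istopology_plots, rule refl)

lemma topspace_path_top [simp]: "topspace (path_top X) = cpaths X"
proof (rule subset_antisym)
  show "topspace (path_top X) \<subseteq> cpaths X"
    using openin_path_top openin_topspace by blast
  have "openin (simplex_top n) {x \<in> standard_simplex n. g x \<in> cpaths X}" if "path_plot n X g" for n g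
  proof -
    have "{x \<in> standard_simplex n. g x \<in> cpaths X} = topspace (simplex_top n)"
      using that by (auto simp: path_plot_def)
    then show ?thesis
      by (simp only: openin_topspace)
  qed
  then have "openin (path_top X) (cpaths X)"
    by (simp add: openin_path_top)
  then show "cpaths X \<subseteq> topspace (path_top X)"
    by (rule openin_subset)
qed

lemma path_plot_imp_continuous_map:
  "path_plot n X g \<Longrightarrow> continuous_map (simplex_top n) (path_top X) g"
  by (auto simp: continuous_map_def openin_path_top path_plot_def)

text \<open>The parameters whose path leaves \<open>W\<close> somewhere on \<open>J\<close> form the
  projection of a closed subset of the simplex times [0,1], and projection along a compact factor is
  a closed map.\<close>

lemma openin_path_top_compact_open:
  assumes J: "closedin unit_top J" and W: "openin X W"
  shows "openin (path_top X) {\<gamma> \<in> cpaths X. \<gamma> ` J \<subseteq> W}"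
proof -
  have "openin (simplex_top n) {x \<in> standard_simplex n. g x \<in> {\<gamma> \<in> cpaths X. \<gamma> ` J \<subseteq> W}}"
    if g: "path_plot n X g" for n g
  proof -
    let ?P = "prod_topology (simplex_top n) unit_top"
    have cont: "continuous_map ?P X (\<lambda>p. g (fst p) (snd p))"
      using g by (simp add: path_plot_def)
    define B where "B = {p \<in> standard_simplex n \<times> {0..1}. g (fst p) (snd p) \<in> topspace X - W}
                          \<inter> (standard_simplex n \<times> J)"
    have "closedin ?P {p \<in> topspace ?P. g (fst p) (snd p) \<in> topspace X - W}"
      using cont W by (intro closedin_continuous_map_preimage) auto
    moreover have "closedin ?P (standard_simplex n \<times> J)"
      using J by (simp add: closedin_prod_Times_iff flip: topspace_simplex_top)
    ultimately have "closedin ?P B"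
      by (simp add: B_def closedin_Int)
    then have "closedin (simplex_top n) (fst ` B)"
      using closed_map_fst[OF compact_space_unit_top] by (auto simp: closed_map_def)
    moreover have "standard_simplex n - fst ` B =
        {x \<in> standard_simplex n. g x \<in> {\<gamma> \<in> cpaths X. \<gamma> ` J \<subseteq> W}}"
    proof -
      have "J \<subseteq> {0..1}" using closedin_subset[OF J] by simp
      moreover have "g x t \<in> topspace X" if "x \<in> standard_simplex n" "t \<in> {0..1}" for x t
        using continuous_map_funspace[OF cont] that by (auto simp: Pi_iff)
      ultimately have "(x, t) \<in> B" if "x \<in> standard_simplex n" "t \<in> J" "g x t \<notin> W" for x t
        using that unfolding B_def by auto
      then have "fst ` B = {x \<in> standard_simplex n. \<exists>t\<in>J. g x t \<notin> W}"
        by (force simp: B_def)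
      then show ?thesis
        using g by (auto simp: path_plot_def)
    qed
    ultimately show ?thesis
      by (metis openin_diff openin_topspace topspace_simplex_top)
  qed
  then show ?thesis
    unfolding openin_path_top by blast
qed

text \<open>Local compactness of [0,1] in the form used for the adjunction: closed subsets of the
  interval are compact.\<close>

lemma unit_closed_nbhd:
  assumes "openin unit_top V" "t \<in> V"
  obtains J O' where "closedin unit_top J" "openin unit_top O'" "t \<in> O'" "O' \<subseteq> J" "J \<subseteq> V"
proof -
  have "regular_space unit_top"
    unfolding unit_top_def
    by (intro metrizable_imp_regular_space metrizable_space_subtopology metrizable_space_euclidean)
  then have "neighbourhood_base_of (closedin unit_top) unit_top"
    by (simp add: neighbourhood_base_of_closedin)
  with assms that show ?thesis
    unfolding neighbourhood_base_of by metis
qed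

text \<open>The topology of the path space refines the compact-open topology, so a continuous map into
  it has a continuous adjoint although it is not assumed to be a plot.\<close>

lemma continuous_map_imp_path_plot:
  assumes cont: "continuous_map (simplex_top n) (path_top X) g"
  shows "path_plot n X g"
proof -
  let ?P = "prod_topology (simplex_top n) unit_top"
  have cp: "g x \<in> cpaths X" if "x \<in> standard_simplex n" for x
    using continuous_map_funspace[OF cont] that by auto
  have cx: "continuous_map unit_top X (g x)" if "x \<in> standard_simplex n" for x
    using cp[OF that] by (simp add: cpaths_def)
  have "openin ?P {p \<in> topspace ?P. g (fst p) (snd p) \<in> W}" if W: "openin X W" for W
  proof (subst openin_subopen, clarsimp)
    fix x t assume xt: "x \<in> standard_simplex n" "0 \<le> t" "t \<le> (1::real)" "g x t \<in> W"
    have "openin unit_top {s \<in> {0..1}. g x s \<in> W}"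
      using openin_continuous_map_preimage[OF cx[OF xt(1)] W] by simp
    then obtain J O' where J: "closedin unit_top J" and O': "openin unit_top O'" "t \<in> O'" "O' \<subseteq> J"
        and JV: "J \<subseteq> {s \<in> {0..1}. g x s \<in> W}"
      using xt by (metis (mono_tags, lifting) atLeastAtMost_iff mem_Collect_eq unit_closed_nbhd)
    \<comment> \<open>All parameters near \<open>x\<close> send the whole of \<open>J\<close> into
      \<open>W\<close>; together with \<open>O'\<close> inside \<open>J\<close> this gives a box
      around \<open>(x, t)\<close> in the preimage of \<open>W\<close>.\<close>
    define N where "N = {y \<in> standard_simplex n. g y \<in> {\<gamma> \<in> cpaths X. \<gamma> ` J \<subseteq> W}}"
    have "openin (simplex_top n) N"
      using openin_continuous_map_preimage[OF cont openin_path_top_compact_open[OF J W]]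
      by (simp add: N_def)
    then have "openin ?P (N \<times> O')"
      using O' by (simp add: openin_prod_Times_iff)
    moreover have "(x, t) \<in> N \<times> O'"
      using xt O' JV cp by (auto simp: N_def)
    moreover have "N \<times> O' \<subseteq> {p. p \<in> standard_simplex n \<times> {0..1} \<and> g (fst p) (snd p) \<in> W}"
      using O' JV by (auto simp: N_def image_subset_iff subset_iff)
    ultimately show "\<exists>T. openin ?P T \<and> (x, t) \<in> T \<and>
        T \<subseteq> {p \<in> standard_simplex n \<times> {0..1}. g (fst p) (snd p) \<in> W}"
      by blast
  qed
  moreover have "g x t \<in> topspace X" if "x \<in> standard_simplex n" "t \<in> {0..1}" for x t
    using continuous_map_funspace[OF cx[OF that(1)]] that(2) by auto
  ultimately have "continuous_map ?P X (\<lambda>p. g (fst p) (snd p))"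
    unfolding continuous_map_def by auto
  with cp show ?thesis
    by (simp add: path_plot_def)
qed

lemma path_plot_iff_continuous_map:
  "path_plot n X g \<longleftrightarrow> continuous_map (simplex_top n) (path_top X) g"
  using continuous_map_imp_path_plot path_plot_imp_continuous_map by blast

lemma path_plot_pmap:
  assumes "path_plot n X g" "continuous_map X Y h"
  shows "path_plot n Y (\<lambda>x. pmap h (g x))"
proof -
  have "continuous_map (prod_topology (simplex_top n) unit_top) Y (h \<circ> (\<lambda>p. g (fst p) (snd p)))"
    using assms continuous_map_compose unfolding path_plot_def by blast
  then have "continuous_map (prod_topology (simplex_top n) unit_top) Y
      (\<lambda>p. pmap h (g (fst p)) (snd p))"
    by (rule continuous_map_eq) (auto simp: pmap_def)
  moreover have "pmap h (g x) \<in> cpaths Y" if "x \<in> standard_simplex n" for x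
  proof -
    have "continuous_map unit_top Y (h \<circ> g x)"
      using assms that by (auto simp: path_plot_def cpaths_def intro: continuous_map_compose)
    then have "continuous_map unit_top Y (pmap h (g x))"
      by (rule continuous_map_eq) (auto simp: pmap_def)
    then show ?thesis
      by (simp add: cpaths_def pmap_def)
  qed
  ultimately show ?thesis
    by (simp add: path_plot_def)
qed

text \<open>Simplices in the kelleyfied subspace are continuous maps into \<open>path_top\<close>
  with values in the subset, and by the adjunction these are path plots.\<close>

lemma openin_dsub_exec_paths:
  assumes "is_mdspace X"
  shows "openin (dsub (path_top (md_top X)) (exec_paths_ab X a b)) U \<longleftrightarrow> U \<subseteq> exec_paths_ab X a b \<and>
     (\<forall>n g. path_plot n (md_top X) g \<longrightarrow> g ` standard_simplex n \<subseteq> exec_paths_ab X a b \<longrightarrow>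
        openin (simplex_top n) {x \<in> standard_simplex n. g x \<in> U})"
proof -
  have "cpaths (md_top X) \<inter> exec_paths_ab X a b = exec_paths_ab X a b"
    using assms by (auto simp: is_mdspace_def exec_paths_ab_def)
  then show ?thesis
    by (auto simp: dsub_def openin_kdelta continuous_map_in_subtopology path_plot_iff_continuous_map
        image_subset_iff_funcset)
qed

lemma openin_exec_top:
  assumes "is_mdspace X"
  shows "openin (exec_top X) U \<longleftrightarrow> U \<subseteq> md_paths X \<and>
     (\<forall>a\<in>md_states X. \<forall>b\<in>md_states X. \<forall>n g. path_plot n (md_top X) g \<longrightarrow>
        g ` standard_simplex n \<subseteq> exec_paths_ab X a b \<longrightarrow>
        openin (simplex_top n) {x \<in> standard_simplex n. g x \<in> U})"
proof -
  let ?Q = "\<lambda>U. U \<subseteq> md_paths X \<and> (\<forall>n g. (path_plot n (md_top X) g \<and>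
        (\<exists>a\<in>md_states X. \<exists>b\<in>md_states X. g ` standard_simplex n \<subseteq> exec_paths_ab X a b)) \<longrightarrow>
        openin (simplex_top n) {x \<in> standard_simplex n. g x \<in> U})"
  \<comment> \<open>A plot with values in one component \<open>E\<close> does not see the
    intersection with \<open>E\<close>, so each component can be tested with \<open>U\<close>
    itself.\<close>
  have eq: "{x \<in> standard_simplex n. g x \<in> U \<and> g x \<in> E} = {x \<in> standard_simplex n. g x \<in> U}"
    if "g ` standard_simplex n \<subseteq> E" for n U E and g :: "_ \<Rightarrow> real \<Rightarrow> 'a"
    using that by auto
  have "(\<lambda>U. U \<subseteq> md_paths X \<and> (\<forall>a\<in>md_states X. \<forall>b\<in>md_states X.
      openin (dsub (path_top (md_top X)) (exec_paths_ab X a b)) (U \<inter> exec_paths_ab X a b))) = ?Q"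
    unfolding openin_dsub_exec_paths[OF assms] by (intro ext, simp add: eq) blast
  then have "exec_top X = topology ?Q"
    by (simp only: exec_top_def)
  moreover have "istopology ?Q"
    by (rule istopology_plots)
  ultimately have "openin (exec_top X) = ?Q"
    by (simp only: topology_inverse')
  then show ?thesis
    by simp blast
qed

lemma topspace_exec_top:
  assumes "is_mdspace X"
  shows "topspace (exec_top X) = md_paths X"
proof (rule subset_antisym)
  show "topspace (exec_top X) \<subseteq> md_paths X"
    using openin_exec_top[OF assms] openin_topspace by blast
  have "openin (simplex_top n) {x \<in> standard_simplex n. g x \<in> md_paths X}"
    if "g ` standard_simplex n \<subseteq> exec_paths_ab X a b" for n g a b
  proof -
    have "{x \<in> standard_simplex n. g x \<in> md_paths X} = topspace (simplex_top n)"
      using that by (auto simp: exec_paths_ab_def)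
    then show ?thesis
      by (simp only: openin_topspace)
  qed
  then have "openin (exec_top X) (md_paths X)"
    unfolding openin_exec_top[OF assms] by blast
  then show "md_paths X \<subseteq> topspace (exec_top X)"
    by (rule openin_subset)
qed

section \<open>Globes\<close>

text \<open>The quotient before kelleyfication: closedness can be checked here on the cylinder and
  is inherited by \<open>glob_top\<close>.\<close>

definition glob_quotient :: "(nat \<Rightarrow> real) set \<Rightarrow> glob_pt topology" where
  "glob_quotient Z = topology (\<lambda>U. U \<subseteq> glob_carrier Z \<and>
     openin (prod_topology (top_of_set Z) unit_top)
        {p \<in> Z \<times> {0..1}. glob_pt (fst p) (snd p) \<in> U})"

lemma glob_top_eq: "glob_top Z = kdelta (glob_quotient Z)"
  by (simp add: glob_top_def glob_quotient_def)

lemma openin_glob_quotient: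
  "openin (glob_quotient Z) U \<longleftrightarrow> U \<subseteq> glob_carrier Z \<and>
     openin (top_of_set (Z \<times> {0..1})) {p \<in> Z \<times> {0..1}. glob_pt (fst p) (snd p) \<in> U}"
proof -
  have eq: "prod_topology (top_of_set Z) unit_top = top_of_set (Z \<times> {0..1})"
    by (simp add: unit_top_def flip: subtopology_Times)
  \<comment> \<open>The quotient map is the only test map, so the index type is
    \<open>unit\<close>.\<close>
  have "istopology (\<lambda>U. U \<subseteq> glob_carrier Z \<and> openin (top_of_set (Z \<times> {0..1}))
        {p \<in> Z \<times> {0..1}. glob_pt (fst p) (snd p) \<in> U})"
    using istopology_plots[of "glob_carrier Z" "\<lambda>_ \<sigma>. \<sigma> = (\<lambda>p. glob_pt (fst p) (snd p))"
        "\<lambda>_::unit. top_of_set (Z \<times> {0..1})" "\<lambda>_. Z \<times> {0..1}"] by simp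
  then show ?thesis
    by (simp add: eq glob_quotient_def)
qed

lemma glob_pt_in_carrier: "z \<in> Z \<Longrightarrow> t \<in> {0..1} \<Longrightarrow> glob_pt z t \<in> glob_carrier Z"
  unfolding glob_carrier_def by (intro UnI2 image_eqI[of _ _ "(z, t)"]) auto

lemma topspace_glob_quotient [simp]: "topspace (glob_quotient Z) = glob_carrier Z"
proof (rule subset_antisym)
  show "topspace (glob_quotient Z) \<subseteq> glob_carrier Z"
    using openin_glob_quotient openin_topspace by blast
  have "{p \<in> Z \<times> {0..1}. glob_pt (fst p) (snd p) \<in> glob_carrier Z} = Z \<times> {0..1}"
    using glob_pt_in_carrier by auto
  then have "openin (glob_quotient Z) (glob_carrier Z)"
    unfolding openin_glob_quotient by simp
  then show "glob_carrier Z \<subseteq> topspace (glob_quotient Z)"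
    by (rule openin_subset)
qed

lemma topspace_glob_top [simp]: "topspace (glob_top Z) = glob_carrier Z"
  by (simp add: glob_top_eq)

lemma closedin_glob_quotient:
  "closedin (glob_quotient Z) C \<longleftrightarrow> C \<subseteq> glob_carrier Z \<and>
     closedin (top_of_set (Z \<times> {0..1})) {p \<in> Z \<times> {0..1}. glob_pt (fst p) (snd p) \<in> C}"
proof -
  have "{p \<in> Z \<times> {0..1}. glob_pt (fst p) (snd p) \<in> glob_carrier Z - C} =
      Z \<times> {0..1} - {p \<in> Z \<times> {0..1}. glob_pt (fst p) (snd p) \<in> C}"
    using glob_pt_in_carrier by auto
  then show ?thesis
    by (auto simp: closedin_def openin_glob_quotient)
qed

lemma continuous_map_glob_quotient:
  assumes "continuous_map T (top_of_set (Z \<times> {0..1})) \<tau>"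
  shows "continuous_map T (glob_quotient Z) (\<lambda>x. glob_pt (fst (\<tau> x)) (snd (\<tau> x)))"
  unfolding continuous_map_def
proof (intro conjI allI impI)
  have im: "\<tau> x \<in> Z \<times> {0..1}" if "x \<in> topspace T" for x
    using continuous_map_funspace[OF assms] that by auto
  then show "(\<lambda>x. glob_pt (fst (\<tau> x)) (snd (\<tau> x))) \<in> topspace T \<rightarrow> topspace (glob_quotient Z)"
    by (auto intro!: glob_pt_in_carrier simp: mem_Times_iff)
  fix U assume "openin (glob_quotient Z) U"
  then have "openin T {x \<in> topspace T. \<tau> x \<in> {p \<in> Z \<times> {0..1}. glob_pt (fst p) (snd p) \<in> U}}"
    by (intro openin_continuous_map_preimage[OF assms]) (simp add: openin_glob_quotient)
  also have "{x \<in> topspace T. \<tau> x \<in> {p \<in> Z \<times> {0..1}. glob_pt (fst p) (snd p) \<in> U}} =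
      {x \<in> topspace T. glob_pt (fst (\<tau> x)) (snd (\<tau> x)) \<in> U}"
    using im by auto
  finally show "openin T {x \<in> topspace T. glob_pt (fst (\<tau> x)) (snd (\<tau> x)) \<in> U}" .
qed

text \<open>For \<open>s = \<plusminus>1\<close> the image of the simplex contains the face \<open>v k = s\<close> of the cube \<open>[-1,1]\<^sup>n\<close>;
  radial projection maps the union of these faces onto the sphere. In \<open>cylinder_patch\<close> the
  barycentric coordinate \<open>n\<close> carries the height and the last one the slack.\<close>

definition cube_face :: "nat \<Rightarrow> nat \<Rightarrow> real \<Rightarrow> (nat \<Rightarrow> real) \<Rightarrow> nat \<Rightarrow> real" where
  "cube_face n k s x = (\<lambda>i. if n \<le> i then 0 else if i = k then s else 2 * (real n + 1) * x i - 1)"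

definition cylinder_patch :: "nat \<Rightarrow> nat \<Rightarrow> real \<Rightarrow> (nat \<Rightarrow> real) \<Rightarrow> (nat \<Rightarrow> real) \<times> real" where
  "cylinder_patch n k s x =
     ((\<lambda>i. cube_face n k s x i / sqrt (\<Sum>j<n. (cube_face n k s x j)\<^sup>2)),
      min 1 ((real n + 1) * x n))"

lemma sum_squares_cube_face_pos:
  assumes "k < n" "s \<noteq> 0"
  shows "0 < (\<Sum>j<n. (cube_face n k s x j)\<^sup>2)"
proof -
  have "0 < (cube_face n k s x k)\<^sup>2"
    using assms by (simp add: cube_face_def)
  then show ?thesis
    using assms by (intro sum_pos2[where i = k]) auto
qed

lemma continuous_on_cylinder_patch:
  assumes "k < n" "s \<noteq> 0"
  shows "continuous_on UNIV (cylinder_patch n k s)"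
proof -
  have c: "continuous_on UNIV (\<lambda>x. cube_face n k s x i)" for i
    unfolding cube_face_def
    by (cases "n \<le> i"; cases "i = k")
      (auto intro!: continuous_intros continuous_on_product_coordinates)
  have pos: "sqrt (\<Sum>j<n. (cube_face n k s x j)\<^sup>2) \<noteq> 0" for x
    using sum_squares_cube_face_pos[OF assms, of x] by simp
  show ?thesis
    unfolding cylinder_patch_def
    by (intro continuous_intros continuous_on_coordinatewise_then_product
        continuous_on_product_coordinates c) (use pos in auto)
qed

text \<open>The height \<open>(n + 1) * x n\<close> can exceed 1 on the simplex; the cut at 1 keeps
  it in the interval.\<close>

lemma cylinder_patch_in:
  assumes "k < n" "s \<noteq> 0" "x \<in> standard_simplex m"
  shows "cylinder_patch n k s x \<in> sphere_m1 n \<times> {0..1}"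
proof -
  let ?N = "\<Sum>j<n. (cube_face n k s x j)\<^sup>2"
  have pos: "0 < ?N"
    using assms by (intro sum_squares_cube_face_pos)
  have "(\<Sum>i<n. (cube_face n k s x i / sqrt ?N)\<^sup>2) = ?N / ?N"
    using pos by (simp add: power_divide flip: sum_divide_distrib)
  also have "\<dots> = 1"
    using pos by simp
  finally have "(\<Sum>i<n. (cube_face n k s x i / sqrt ?N)\<^sup>2) = 1" .
  moreover have "cube_face n k s x i / sqrt ?N = 0" if "i \<ge> n" for i
    using that by (simp add: cube_face_def)
  moreover have "0 \<le> x n"
    using assms by (simp add: standard_simplex_def)
  ultimately show ?thesis
    by (simp add: cylinder_patch_def sphere_m1_def)
qed

text \<open>A coordinate \<open>k\<close> of maximal modulus \<open>c\<close> selects the face: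
  \<open>z / c\<close> lies in the cube, has \<open>k\<close>-th coordinate equal to the sign
  \<open>s\<close> of \<open>z k\<close>, and projects back to \<open>z\<close>.\<close>

lemma cylinder_patch_surj:
  assumes z: "z \<in> sphere_m1 n" and t: "t \<in> {0..1}"
  obtains k s x where "k < n" "s \<in> {1, -1}" "x \<in> standard_simplex (Suc n)"
    "cylinder_patch n k s x = (z, t)"
proof -
  have z0: "z i = 0" if "i \<ge> n" for i
    using z that by (simp add: sphere_m1_def)
  have z1: "(\<Sum>i<n. (z i)\<^sup>2) = 1"
    using z by (simp add: sphere_m1_def)
  have "n \<noteq> 0"
    using z1 by (intro notI) simp
  obtain k where k: "k < n" "\<And>i. i < n \<Longrightarrow> \<bar>z i\<bar> \<le> \<bar>z k\<bar>"
  proof -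
    have "Max ((\<lambda>i. \<bar>z i\<bar>) ` {..<n}) \<in> (\<lambda>i. \<bar>z i\<bar>) ` {..<n}"
      using \<open>n \<noteq> 0\<close> by (intro Max_in) auto
    then obtain k where "k < n" "Max ((\<lambda>i. \<bar>z i\<bar>) ` {..<n}) = \<bar>z k\<bar>"
      by auto
    moreover have "\<bar>z i\<bar> \<le> Max ((\<lambda>i. \<bar>z i\<bar>) ` {..<n})" if "i < n" for i
      using that by (intro Max_ge) auto
    ultimately show ?thesis
      using that by simp
  qed
  define c where "c = \<bar>z k\<bar>"
  have "c > 0"
  proof (rule ccontr)
    assume "\<not> c > 0"
    then have "z i = 0" if "i < n" for i
      using k(2)[OF that] by (simp add: c_def)
    then show False
      using z1 by simp
  qed
  define s where "s = sgn (z k)"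
  have s: "s \<in> {1, -1}" "s * c = z k"
    using \<open>c > 0\<close> by (auto simp: s_def c_def sgn_if)
  \<comment> \<open>Inverts the affine map from [0,1] onto [-1,1] used in \<open>cube_face\<close>;
    slot \<open>n\<close> stores the height.\<close>
  define u where "u i = (if i < n then (z i / c + 1) / 2 else if i = n then t else 0)" for i
  have u: "0 \<le> u i" "u i \<le> 1" for i
  proof -
    have "\<bar>z i / c\<bar> \<le> 1" if "i < n"
      using k(2)[OF that] \<open>c > 0\<close> by (simp add: c_def)
    then show "0 \<le> u i" "u i \<le> 1"
      using t unfolding u_def by (auto simp only: abs_le_iff split: if_splits) auto
  qed
  \<comment> \<open>There are \<open>n + 1\<close> values in [0,1], so after division by
    \<open>n + 1\<close> their sum is at most 1 and the last barycentric coordinate takes the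
    rest.\<close>
  define y where "y i = u i / (real n + 1)" for i
  have y: "0 \<le> y i" "y i \<le> 1 / (real n + 1)" for i
    using u[of i] unfolding y_def by (auto intro: divide_right_mono)
  define x where "x = y(Suc n := 1 - (\<Sum>i\<le>n. y i))"
  have "(\<Sum>i\<le>n. y i) \<le> (\<Sum>i\<le>n. 1 / (real n + 1))"
    using y by (intro sum_mono)
  also have "\<dots> = 1"
    by (simp add: divide_simps)
  finally have ys: "0 \<le> (\<Sum>i\<le>n. y i)" "(\<Sum>i\<le>n. y i) \<le> 1"
    using y by (auto intro: sum_nonneg)
  have y1: "y i \<le> 1" for i
    using y(2)[of i] by (rule order_trans) simp
  have "(\<Sum>i\<le>Suc n. x i) = 1"
    by (simp add: x_def)
  then have "x \<in> standard_simplex (Suc n)"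
    using y(1) y1 ys by (auto simp: standard_simplex_def x_def) (auto simp: y_def u_def)
  moreover have "cylinder_patch n k s x = (z, t)"
  proof -
    have n1: "real n + 1 \<noteq> 0"
      by simp
    have yu: "(real n + 1) * y i = u i" for i
      unfolding y_def times_divide_eq_right by (rule nonzero_mult_div_cancel_left[OF n1])
    have "2 * (real n + 1) * x i - 1 = z i / c" if "i < n" for i
    proof -
      have "2 * (real n + 1) * x i = 2 * ((real n + 1) * y i)"
        using that by (simp add: x_def)
      also have "\<dots> = z i / c + 1"
        using that unfolding yu by (simp add: u_def)
      finally show ?thesis
        by linarith
    qed
    then have cf: "cube_face n k s x i = z i / c" for i
      using z0[of i] s(2) \<open>c > 0\<close> by (auto simp: cube_face_def field_simps)
    have "(\<Sum>j<n. (cube_face n k s x j)\<^sup>2) = (\<Sum>j<n. (z j)\<^sup>2) / c\<^sup>2"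
      by (simp add: cf power_divide sum_divide_distrib)
    then have norm: "sqrt (\<Sum>j<n. (cube_face n k s x j)\<^sup>2) = 1 / c"
      using z1 \<open>c > 0\<close> by (simp add: real_sqrt_divide)
    have "(real n + 1) * x n = t"
      using yu[of n] by (simp add: x_def u_def)
    then show ?thesis
      unfolding cylinder_patch_def norm unfolding cf using t \<open>c > 0\<close> by simp
  qed
  ultimately show ?thesis
    using that k(1) s(1) by blast
qed

text \<open>The cylinder over the sphere is a finite union of images of simplices, hence is
  \<open>\<Delta>\<close>-generated: the kelleyfication does not add closed subsets to its quotient.\<close>

lemma compact_glob_sphere_preimage:
  assumes C: "closedin (glob_top (sphere_m1 n)) C"
  shows "compact {p \<in> sphere_m1 n \<times> {0..1}. glob_pt (fst p) (snd p) \<in> C}"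
proof -
  let ?S = "standard_simplex (Suc n)"
  let ?Z = "sphere_m1 n"
  define K where "K = (\<lambda>(k, s). {x \<in> ?S.
    glob_pt (fst (cylinder_patch n k s x)) (snd (cylinder_patch n k s x)) \<in> C})"
  have cpt: "compact (cylinder_patch n k s ` K (k, s))" if ks: "k < n" "s \<in> {1, -1}" for k s
  proof -
    have s: "s \<noteq> 0" using ks by auto
    have con: "continuous_on ?S (cylinder_patch n k s)"
      using continuous_on_cylinder_patch[OF ks(1) s] continuous_on_subset by blast
    then have "continuous_map (simplex_top (Suc n)) (top_of_set (?Z \<times> {0..1})) (cylinder_patch n k s)"
      using cylinder_patch_in[OF ks(1) s, of _ "Suc n"]
      by (auto simp: simplex_top_eq continuous_map_in_subtopology image_subset_iff_funcset)
    \<comment> \<open>Because the source is a simplex, continuity persists into the kelleyfied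
      globe, where \<open>C\<close> is known to be closed.\<close>
    then have "continuous_map (simplex_top (Suc n)) (glob_top ?Z)
        (\<lambda>x. glob_pt (fst (cylinder_patch n k s x)) (snd (cylinder_patch n k s x)))"
      unfolding glob_top_eq continuous_map_simplex_kdelta by (rule continuous_map_glob_quotient)
    from closedin_continuous_map_preimage[OF this C]
    have "closedin (top_of_set ?S) (K (k, s))"
      by (simp add: K_def simplex_top_eq)
    moreover have "compact ?S"
      using compactin_standard_simplex by (simp add: euclidean_product_topology)
    ultimately have "compact (K (k, s))"
      using closedin_compact by blast
    then show ?thesis
      using con by (intro compact_continuous_image) (auto simp: K_def intro: continuous_on_subset)
  qed
  have "{p \<in> ?Z \<times> {0..1}. glob_pt (fst p) (snd p) \<in> C} =
      (\<Union>(k, s) \<in> {..<n} \<times> {1, -1}. cylinder_patch n k s ` K (k, s))" (is "?L = ?R")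
  proof (rule subset_antisym)
    show "?R \<subseteq> ?L"
    proof
      fix p assume "p \<in> ?R"
      then obtain k s x where *: "k < n" "s \<in> {1, -1}" "x \<in> K (k, s)" "p = cylinder_patch n k s x"
        by auto
      then have "s \<noteq> 0" "x \<in> ?S"
        by (auto simp: K_def)
      then have "p \<in> ?Z \<times> {0..1}"
        using * cylinder_patch_in by blast
      then show "p \<in> ?L"
        using * by (auto simp: K_def)
    qed
    show "?L \<subseteq> ?R"
    proof
      fix p assume p: "p \<in> ?L"
      then have "fst p \<in> ?Z" "snd p \<in> {0..1}"
        by auto
      then obtain k s x where ks: "k < n" "s \<in> {1, -1}"
          and x: "x \<in> ?S" "cylinder_patch n k s x = (fst p, snd p)"
        by (rule cylinder_patch_surj)
      then have "p \<in> cylinder_patch n k s ` K (k, s)"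
        using p unfolding K_def by (intro image_eqI[of _ _ x]) auto
      moreover have "(k, s) \<in> {..<n} \<times> {1, -1}"
        using ks by auto
      ultimately show "p \<in> ?R"
        by blast
    qed
  qed
  also have "compact \<dots>"
    using cpt by (intro compact_UN) auto
  finally show ?thesis .
qed

section \<open>From the boundary globe to the disk globe\<close>

lemma sphere_subset_disk: "sphere_m1 n \<subseteq> disk n"
  by (auto simp: sphere_m1_def disk_def)

lemma glob_carrier_mono: "Y \<subseteq> Z \<Longrightarrow> glob_carrier Y \<subseteq> glob_carrier Z"
  by (auto simp: glob_carrier_def)

lemma Inr_in_glob_carrier: "Inr p \<in> glob_carrier Z \<longleftrightarrow> fst p \<in> Z \<and> 0 < snd p \<and> snd p < 1"
  by (cases p) (auto simp: glob_carrier_def glob_pt_def image_iff)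

text \<open>The preimage of \<open>C\<close> in the cylinder over the sphere is compact, and
  therefore stays closed in the larger cylinder over the disk.\<close>

lemma closedin_glob_sphere_imp_disk:
  assumes C: "closedin (glob_top (sphere_m1 n)) C"
  shows "closedin (glob_top (disk n)) C"
proof -
  let ?S = "sphere_m1 n" let ?D = "disk n"
  have CS: "C \<subseteq> glob_carrier ?S"
    using closedin_subset[OF C] by simp
  let ?C1 = "{p \<in> ?S \<times> {0..1}. glob_pt (fst p) (snd p) \<in> C}"
  \<comment> \<open>In the disk globe the fibre over a pole is the whole disk times an end of the
    interval, not only the part over the sphere.\<close>
  let ?E = "(if Inl False \<in> C then {0} else {}) \<union> (if Inl True \<in> C then {1} else {}) :: real set"
  have "closed ?C1"
    using compact_glob_sphere_preimage[OF C] by (rule compact_imp_closed)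
  then have "closedin (top_of_set (?D \<times> {0..1})) ?C1"
    using sphere_subset_disk[of n] by (intro closed_subset) auto
  moreover have "closedin (top_of_set (?D \<times> {0..1})) (?D \<times> ?E)"
  proof -
    have "closed (UNIV \<times> ?E :: ((nat \<Rightarrow> real) \<times> real) set)"
      by (intro closed_Times) auto
    moreover have "?D \<times> ?E = (?D \<times> {0..1}) \<inter> (UNIV \<times> ?E)"
      by (auto split: if_splits)
    ultimately show ?thesis
      by (metis closedin_closed_Int)
  qed
  moreover have "{p \<in> ?D \<times> {0..1}. glob_pt (fst p) (snd p) \<in> C} = ?C1 \<union> ?D \<times> ?E"
    using CS sphere_subset_disk[of n]
    by (auto simp: glob_pt_def subset_iff Inr_in_glob_carrier split: if_splits)
  ultimately have "closedin (glob_quotient ?D) C"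
    using CS glob_carrier_mono[OF sphere_subset_disk, of n] unfolding closedin_glob_quotient
    by (metis (no_types, lifting) closedin_Un order_trans)
  then show ?thesis
    by (simp add: glob_top_eq closedin_imp_closedin_kdelta)
qed

text \<open>A point off the poles has exactly one preimage in the cylinder. The poles belong to
  every boundary globe, so all points of an open cell are covered.\<close>

lemma closedin_glob_singleton:
  assumes x: "x \<in> glob_carrier Z - {Inl False, Inl True}"
  shows "closedin (glob_top Z) {x}"
proof -
  obtain z t where x_eq: "x = Inr (z, t)" 
    using x by (auto simp: glob_carrier_def glob_pt_def split: if_splits)
  with x have zt: "z \<in> Z" "0 < t" "t < 1"
    by (auto simp: Inr_in_glob_carrier)
  then have "{p \<in> Z \<times> {0..1}. glob_pt (fst p) (snd p) \<in> {x}} = {(z, t)}"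
    by (auto simp: x_eq glob_pt_def)
  then have "closedin (glob_quotient Z) {x}"
    using x zt unfolding closedin_glob_quotient by (auto intro!: closed_subset)
  then show ?thesis
    by (simp add: glob_top_eq closedin_imp_closedin_kdelta)
qed

section \<open>Attaching a globe\<close>

lemma pmap_apply [simp]: "t \<in> {0..1} \<Longrightarrow> pmap f \<gamma> t = f (\<gamma> t)"
  by (simp add: pmap_def)

lemma pmap_cong: "(\<And>t. t \<in> {0..1} \<Longrightarrow> f (\<gamma> t) = g (\<delta> t)) \<Longrightarrow> pmap f \<gamma> = pmap g \<delta>"
  by (auto simp: pmap_def restrict_def)

lemma reparam_image: "\<phi> \<in> reparam \<Longrightarrow> \<phi> ` {0..1} = {0..1}"
  using homeomorphic_imp_surjective_map by (fastforce simp: reparam_def)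

lemma pmap_reparam:
  assumes "\<phi> \<in> reparam"
  shows "restrict (pmap f \<gamma> \<circ> \<phi>) {0..1} = pmap f (restrict (\<gamma> \<circ> \<phi>) {0..1})"
proof -
  have "\<phi> t \<in> {0..1}" if "t \<in> {0..1}" for t
    using reparam_image[OF assms] that by blast
  then show ?thesis
    by (auto simp: pmap_def restrict_def fun_eq_iff)
qed

lemma pmap_ncomp: "ncomp (pmap f \<gamma>) (pmap f \<delta>) = pmap f (ncomp \<gamma> \<delta>)"
  by (auto simp: pmap_def ncomp_def restrict_def fun_eq_iff)

lemma ncomp_image:
  assumes "\<gamma> 1 = \<delta> 0"
  shows "ncomp \<gamma> \<delta> ` {0..1} = \<gamma> ` {0..1} \<union> \<delta> ` {0..1}"
proof (rule subset_antisym)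
  show "ncomp \<gamma> \<delta> ` {0..1} \<subseteq> \<gamma> ` {0..1} \<union> \<delta> ` {0..1}"
    by (auto simp: ncomp_def)
  have "\<gamma> t \<in> ncomp \<gamma> \<delta> ` {0..1}" if "t \<in> {0..1}" for t
    using that by (intro image_eqI[of _ _ "t / 2"]) (auto simp: ncomp_def)
  moreover have "\<delta> t \<in> ncomp \<gamma> \<delta> ` {0..1}" if "t \<in> {0..1}" for t
  proof -
    have "2 * ((t + 1) / 2) - 1 = t"
      by (simp add: field_simps)
    then show ?thesis
      using that assms by (intro image_eqI[of _ _ "(t + 1) / 2"]) (auto simp: ncomp_def)
  qed
  ultimately show "\<gamma> ` {0..1} \<union> \<delta> ` {0..1} \<subseteq> ncomp \<gamma> \<delta> ` {0..1}"
    by blast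
qed

lemma gen_paths_induct:
  assumes "\<gamma> \<in> gen_paths S" and "S \<subseteq> P" and "path_closed P"
  shows "\<gamma> \<in> P"
  using assms by (auto simp: gen_paths_def)

lemma gen_paths_superset: "S \<subseteq> gen_paths S"
  by (auto simp: gen_paths_def)

lemma mdspace_path_in_topspace:
  assumes "is_mdspace X" "\<gamma> \<in> md_paths X" "t \<in> {0..1}"
  shows "\<gamma> t \<in> topspace (md_top X)"
proof -
  have "continuous_map unit_top (md_top X) \<gamma>"
    using assms by (auto simp: is_mdspace_def cpaths_def)
  from continuous_map_funspace[OF this] show ?thesis
    using assms(3) by auto
qed

lemma closedin_pushoutI:
  assumes P: "glob_pushout n g X Y f gh" and C: "C \<subseteq> topspace (md_top Y)"
    and 1: "closedin (md_top X) {x \<in> topspace (md_top X). f x \<in> C}"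
    and 2: "closedin (glob_top (disk n)) {x \<in> glob_carrier (disk n). gh x \<in> C}"
  shows "closedin (md_top Y) C"
proof -
  have top: "topspace (md_top Y) = f ` topspace (md_top X) \<union> gh ` glob_carrier (disk n)"
    and ope: "\<And>U. openin (md_top Y) U \<longleftrightarrow> U \<subseteq> topspace (md_top Y) \<and>
         openin (md_top X) {x \<in> topspace (md_top X). f x \<in> U} \<and>
         openin (glob_top (disk n)) {x \<in> glob_carrier (disk n). gh x \<in> U}"
    using P by (simp_all add: glob_pushout_def Let_def)
  have "{x \<in> topspace (md_top X). f x \<in> topspace (md_top Y) - C} =
      topspace (md_top X) - {x \<in> topspace (md_top X). f x \<in> C}"
    using top by auto
  moreover have "{x \<in> glob_carrier (disk n). gh x \<in> topspace (md_top Y) - C} =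
      glob_carrier (disk n) - {x \<in> glob_carrier (disk n). gh x \<in> C}"
    using top by auto
  ultimately have "openin (md_top Y) (topspace (md_top Y) - C)"
    using 1 2 unfolding ope closedin_def by simp
  with C show ?thesis
    by (simp add: closedin_def)
qed

text \<open>Continuity of \<open>g\<close> gives closedness in the boundary globe only; the transfer
  to the disk globe is needed because the pushout topology is tested there.\<close>

lemma closedin_glob_attaching:
  assumes P: "glob_pushout n g X Y f gh" and C: "closedin (md_top X) C"
  shows "closedin (glob_top (disk n)) {a \<in> glob_carrier (sphere_m1 n). g a \<in> C}"
proof -
  have "continuous_map (glob_top (sphere_m1 n)) (md_top X) g"
    using P by (simp add: glob_pushout_def md_map_def Glob_def Let_def)
  from closedin_continuous_map_preimage[OF this C] show ?thesis
    by (intro closedin_glob_sphere_imp_disk) simp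
qed

lemma glob_attaching_in_topspace:
  assumes "glob_pushout n g X Y f gh" "a \<in> glob_carrier (sphere_m1 n)"
  shows "g a \<in> topspace (md_top X)" "gh a = f (g a)"
proof -
  have "continuous_map (glob_top (sphere_m1 n)) (md_top X) g"
    using assms(1) by (simp add: glob_pushout_def md_map_def Glob_def Let_def)
  from continuous_map_funspace[OF this] show "g a \<in> topspace (md_top X)"
    using assms(2) by auto
  show "gh a = f (g a)"
    using assms by (simp add: glob_pushout_def Let_def)
qed

lemma glob_pushout_inj: "glob_pushout n g X Y f gh \<Longrightarrow> inj_on f (topspace (md_top X))"
  by (simp add: glob_pushout_def Let_def)

lemma glob_pushout_cell_disjoint:
  assumes "glob_pushout n g X Y f gh" "x \<in> glob_carrier (disk n) - glob_carrier (sphere_m1 n)"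
  shows "gh x \<notin> f ` topspace (md_top X)"
  using assms unfolding glob_pushout_def Let_def by blast

text \<open>The open cell misses the image of \<open>f\<close> and \<open>f\<close> is injective, so
  the preimage under \<open>gh\<close> of the image of \<open>C\<close> is just the preimage of
  \<open>C\<close> under the attaching map.\<close>

lemma glob_pushout_closed_map:
  assumes P: "glob_pushout n g X Y f gh"
  shows "closed_map (md_top X) (md_top Y) f"
  unfolding closed_map_def
proof (intro allI impI)
  fix C assume C: "closedin (md_top X) C"
  then have CX: "C \<subseteq> topspace (md_top X)"
    by (rule closedin_subset)
  note inj = glob_pushout_inj[OF P]
  show "closedin (md_top Y) (f ` C)"
  proof (rule closedin_pushoutI[OF P])
    show "f ` C \<subseteq> topspace (md_top Y)"
      using P CX by (auto simp: glob_pushout_def Let_def)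
    have "{x \<in> topspace (md_top X). f x \<in> f ` C} = C"
      using inj_on_image_mem_iff[OF inj _ CX] CX by auto
    with C show "closedin (md_top X) {x \<in> topspace (md_top X). f x \<in> f ` C}"
      by simp
    have "x \<in> glob_carrier (disk n) \<and> gh x \<in> f ` C \<longleftrightarrow>
        x \<in> glob_carrier (sphere_m1 n) \<and> g x \<in> C" for x
    proof (cases "x \<in> glob_carrier (sphere_m1 n)")
      case True
      then show ?thesis
        using glob_attaching_in_topspace[OF P True] glob_carrier_mono[OF sphere_subset_disk, of n]
          inj CX by (auto simp: inj_on_image_mem_iff)
    next
      case False
      then show ?thesis
        using glob_pushout_cell_disjoint[OF P, of x] CX by blast
    qed
    with closedin_glob_attaching[OF P C]
    show "closedin (glob_top (disk n)) {x \<in> glob_carrier (disk n). gh x \<in> f ` C}"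
      by simp
  qed
qed

text \<open>An execution path of the pushout is a composite of paths of \<open>X\<close> and of globe paths; one that
  stays in \<open>X\<close> cannot contain a globe path through the interior of the disk.\<close>

lemma glob_pushout_path_reflect:
  assumes P: "glob_pushout n g X Y f gh" and X: "is_mdspace X"
    and \<gamma>: "\<gamma> \<in> md_paths Y" "\<gamma> ` {0..1} \<subseteq> f ` topspace (md_top X)"
  shows "\<gamma> \<in> pmap f ` md_paths X"
proof -
  let ?X = "topspace (md_top X)"
  \<comment> \<open>Staying in the image of \<open>X\<close> is a premise inside \<open>Q\<close>:
    globe paths through the open cell then satisfy \<open>Q\<close> vacuously, and the premise for a
    composite passes to both factors.\<close>
  define Q where "Q = {\<gamma>. \<gamma> ` {0..1} \<subseteq> f ` ?X \<longrightarrow> \<gamma> \<in> pmap f ` md_paths X}"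
  have cX: "path_closed (md_paths X)"
    using X by (simp add: is_mdspace_def)
  have "pmap gh \<delta> \<in> Q" if \<delta>: "\<delta> \<in> md_paths (Glob (disk n))" for \<delta>
  proof -
    obtain z \<phi> where z: "z \<in> disk n" and \<phi>: "\<phi> \<in> reparam"
      and \<delta>_eq: "\<delta> = restrict (\<lambda>t. glob_pt z (\<phi> t)) {0..1}"
      using \<delta> by (auto simp: Glob_def)
    have \<phi>im: "\<phi> ` {0..1} = {0..1}"
      using \<phi> by (rule reparam_image)
    show ?thesis
    proof (cases "z \<in> sphere_m1 n")
      case True
      then have "\<delta> \<in> md_paths (Glob (sphere_m1 n))"
        using \<phi> \<delta>_eq by (auto simp: Glob_def)
      then have "pmap g \<delta> \<in> md_paths X"
        using P by (auto simp: glob_pushout_def Let_def md_map_def)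
      moreover have "pmap gh \<delta> = pmap f (pmap g \<delta>)"
      proof (rule pmap_cong)
        fix t :: real assume t: "t \<in> {0..1}"
        then have "\<phi> t \<in> {0..1}"
          using \<phi>im by blast
        then have "\<delta> t \<in> glob_carrier (sphere_m1 n)"
          using True t by (simp add: \<delta>_eq glob_pt_in_carrier)
        with t show "gh (\<delta> t) = f (pmap g \<delta> t)"
          by (simp add: glob_attaching_in_topspace[OF P])
      qed
      ultimately show ?thesis
        by (auto simp: Q_def)
    next
      case False
      \<comment> \<open>A homeomorphism of [0,1] attains 1/2, a height at which nothing is
        identified, so the path meets the open cell.\<close>
      have "1/2 \<in> \<phi> ` {0..1}"
        using \<phi>im by simp
      then obtain t where t: "t \<in> {0..1}" "\<phi> t = 1/2"
        by (metis imageE)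
      then have "\<delta> t = Inr (z, 1/2)"
        by (simp add: \<delta>_eq glob_pt_def)
      then have "\<delta> t \<in> glob_carrier (disk n) - glob_carrier (sphere_m1 n)"
        using z False by (simp add: Inr_in_glob_carrier)
      then have "pmap gh \<delta> t \<notin> f ` ?X"
        using glob_pushout_cell_disjoint[OF P] t(1) by simp
      then have "\<not> pmap gh \<delta> ` {0..1} \<subseteq> f ` ?X"
        using t(1) by blast
      then show ?thesis
        unfolding Q_def by blast
    qed
  qed
  then have "pmap f ` md_paths X \<union> pmap gh ` md_paths (Glob (disk n)) \<subseteq> Q"
    by (auto simp: Q_def)
  moreover have "path_closed Q"
    unfolding path_closed_def
  proof (intro conjI ballI impI)
    fix \<gamma> \<phi> assume \<gamma>: "\<gamma> \<in> Q" and \<phi>: "\<phi> \<in> reparam"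
    have im: "restrict (\<gamma> \<circ> \<phi>) {0..1} ` {0..1} = \<gamma> ` {0..1}"
    proof -
      have "restrict (\<gamma> \<circ> \<phi>) {0..1} ` {0..1} = \<gamma> ` \<phi> ` {0..1}"
        by (simp add: image_image)
      then show ?thesis
        by (simp only: reparam_image[OF \<phi>])
    qed
    show "restrict (\<gamma> \<circ> \<phi>) {0..1} \<in> Q"
      unfolding Q_def mem_Collect_eq im
    proof
      assume "\<gamma> ` {0..1} \<subseteq> f ` ?X"
      then obtain \<delta> where "\<delta> \<in> md_paths X" "\<gamma> = pmap f \<delta>"
        using \<gamma> by (auto simp: Q_def)
      then show "restrict (\<gamma> \<circ> \<phi>) {0..1} \<in> pmap f ` md_paths X"
        using cX \<phi> by (simp add: pmap_reparam path_closed_def)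
    qed
  next
    fix \<gamma>1 \<gamma>2 assume \<gamma>: "\<gamma>1 \<in> Q" "\<gamma>2 \<in> Q" and eq: "\<gamma>1 1 = \<gamma>2 0"
    show "ncomp \<gamma>1 \<gamma>2 \<in> Q"
      unfolding Q_def mem_Collect_eq ncomp_image[of \<gamma>1 \<gamma>2, OF eq]
    proof
      assume "\<gamma>1 ` {0..1} \<union> \<gamma>2 ` {0..1} \<subseteq> f ` ?X"
      then obtain \<delta>1 \<delta>2 where \<delta>: "\<delta>1 \<in> md_paths X" "\<gamma>1 = pmap f \<delta>1"
          "\<delta>2 \<in> md_paths X" "\<gamma>2 = pmap f \<delta>2"
        using \<gamma> by (auto simp: Q_def)
      \<comment> \<open>Injectivity of \<open>f\<close> makes the two lifts composable in
        \<open>X\<close>.\<close>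
      then have "\<delta>1 1 = \<delta>2 0"
        using eq glob_pushout_inj[OF P]
        by (simp add: inj_on_eq_iff mdspace_path_in_topspace[OF X])
      then show "ncomp \<gamma>1 \<gamma>2 \<in> pmap f ` md_paths X"
        using cX \<delta> by (simp add: pmap_ncomp path_closed_def)
    qed
  qed
  moreover have "\<gamma> \<in> gen_paths (pmap f ` md_paths X \<union> pmap gh ` md_paths (Glob (disk n)))"
    using \<gamma>(1) P by (simp add: glob_pushout_def Let_def)
  ultimately have "\<gamma> \<in> Q"
    by (rule gen_paths_induct[rotated])
  with \<gamma>(2) show ?thesis
    by (simp add: Q_def)
qed

section \<open>Towers of globes\<close>

lemma wellorder_trichotomy:
  obtains "is_least \<nu>" | \<mu> where "is_succ \<mu> \<nu>" | "is_limit \<nu>"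
  unfolding is_least_def is_succ_def is_limit_def by (metis not_le_imp_less)

lemma is_succ_less: "is_succ \<mu> \<nu> \<Longrightarrow> \<mu> < \<nu>"
  by (simp add: is_succ_def)

lemma is_succ_lessD: "is_succ \<mu> \<nu> \<Longrightarrow> \<rho> < \<nu> \<Longrightarrow> \<rho> \<le> \<mu>"
  unfolding is_succ_def by (metis leD not_le_imp_less)

locale globular_tower =
  fixes lam :: "'i::wellorder"
    and X :: "'i \<Rightarrow> 'a mdspace"
    and f :: "'i \<Rightarrow> 'i \<Rightarrow> 'a \<Rightarrow> 'a"
  assumes mds: "\<nu> < lam \<Longrightarrow> is_mdspace (X \<nu>)"
    and maps: "\<mu> \<le> \<nu> \<Longrightarrow> \<nu> < lam \<Longrightarrow> md_map (X \<mu>) (X \<nu>) (f \<mu> \<nu>)"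
    and fid: "\<nu> < lam \<Longrightarrow> x \<in> topspace (md_top (X \<nu>)) \<Longrightarrow> f \<nu> \<nu> x = x"
    and fcomp: "\<mu> \<le> \<nu> \<Longrightarrow> \<nu> \<le> \<rho> \<Longrightarrow> \<rho> < lam \<Longrightarrow> x \<in> topspace (md_top (X \<mu>)) \<Longrightarrow>
                  f \<mu> \<rho> x = f \<nu> \<rho> (f \<mu> \<nu> x)"
    and zero: "\<nu> < lam \<Longrightarrow> is_least \<nu> \<Longrightarrow> \<exists>E. X \<nu> = md_set E"
    and succ: "\<nu>' < lam \<Longrightarrow> is_succ \<nu> \<nu>' \<Longrightarrow>
                 \<exists>n g gh. glob_pushout n g (X \<nu>) (X \<nu>') (f \<nu> \<nu>') gh"
    and limit: "\<nu> < lam \<Longrightarrow> is_limit \<nu> \<Longrightarrow> md_colimit {\<mu>. \<mu> < \<nu>} X f (X \<nu>) (\<lambda>\<mu>. f \<mu> \<nu>)"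
begin

abbreviation sp :: "'i \<Rightarrow> 'a set" where
  "sp \<nu> \<equiv> topspace (md_top (X \<nu>))"

lemma f_continuous: "\<mu> \<le> \<nu> \<Longrightarrow> \<nu> < lam \<Longrightarrow> continuous_map (md_top (X \<mu>)) (md_top (X \<nu>)) (f \<mu> \<nu>)"
  using maps by (simp add: md_map_def)

lemma f_in_sp: "\<mu> \<le> \<nu> \<Longrightarrow> \<nu> < lam \<Longrightarrow> x \<in> sp \<mu> \<Longrightarrow> f \<mu> \<nu> x \<in> sp \<nu>"
  using continuous_map_funspace[OF f_continuous] by blast

text \<open>Limit stages below \<open>lam\<close> and the colimit \<open>Xlam\<close> are both
  instances, so statements about colimits are proved once for both.\<close>

definition colimit_cocone :: "'i \<Rightarrow> 'a mdspace \<Rightarrow> ('i \<Rightarrow> 'a \<Rightarrow> 'a) \<Rightarrow> bool" where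
  "colimit_cocone \<kappa> Y h \<longleftrightarrow> \<kappa> \<le> lam \<and> is_mdspace Y \<and> (\<forall>\<nu><\<kappa>. md_map (X \<nu>) Y (h \<nu>)) \<and>
     (\<forall>\<nu> \<rho>. \<nu> \<le> \<rho> \<and> \<rho> < \<kappa> \<longrightarrow> (\<forall>x\<in>sp \<nu>. h \<nu> x = h \<rho> (f \<nu> \<rho> x))) \<and>
     md_colimit {\<nu>. \<nu> < \<kappa>} X f Y h"

lemma colimit_cocone_limit:
  assumes "\<nu> < lam" "is_limit \<nu>"
  shows "colimit_cocone \<nu> (X \<nu>) (\<lambda>\<mu>. f \<mu> \<nu>)"
  unfolding colimit_cocone_def
  using assms mds maps limit fcomp by (auto simp: less_imp_le)

context
  fixes \<kappa> Y h
  assumes cocone: "colimit_cocone \<kappa> Y h"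
begin

lemma below_lam: "\<nu> < \<kappa> \<Longrightarrow> \<nu> < lam"
  using cocone by (auto simp: colimit_cocone_def)

lemma h_continuous: "\<nu> < \<kappa> \<Longrightarrow> continuous_map (md_top (X \<nu>)) (md_top Y) (h \<nu>)"
  using cocone by (simp add: colimit_cocone_def md_map_def)

lemma h_in_topspace: "\<nu> < \<kappa> \<Longrightarrow> x \<in> sp \<nu> \<Longrightarrow> h \<nu> x \<in> topspace (md_top Y)"
  using continuous_map_funspace[OF h_continuous] by blast

lemma h_f: "\<nu> \<le> \<rho> \<Longrightarrow> \<rho> < \<kappa> \<Longrightarrow> x \<in> sp \<nu> \<Longrightarrow> h \<rho> (f \<nu> \<rho> x) = h \<nu> x"
  using cocone by (simp add: colimit_cocone_def)

lemma h_image_mono: "\<nu> \<le> \<rho> \<Longrightarrow> \<rho> < \<kappa> \<Longrightarrow> h \<nu> ` sp \<nu> \<subseteq> h \<rho> ` sp \<rho>"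
  using h_f f_in_sp below_lam by (metis (no_types, lifting) image_eqI image_subsetI)

lemma colimit_topspace: "topspace (md_top Y) = (\<Union>\<nu>\<in>{..<\<kappa>}. h \<nu> ` sp \<nu>)"
  using cocone by (simp add: colimit_cocone_def md_colimit_def lessThan_def)

lemma colimit_eqD:
  assumes "i < \<kappa>" "j < \<kappa>" "x \<in> sp i" "y \<in> sp j" "h i x = h j y"
  obtains k where "k < \<kappa>" "i \<le> k" "j \<le> k" "f i k x = f j k y"
proof -
  have "\<forall>i<\<kappa>. \<forall>j<\<kappa>. \<forall>x\<in>sp i. \<forall>y\<in>sp j. h i x = h j y \<longrightarrow>
      (\<exists>k<\<kappa>. i \<le> k \<and> j \<le> k \<and> f i k x = f j k y)"
    using cocone by (simp add: colimit_cocone_def md_colimit_def)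
  with assms that show ?thesis
    by blast
qed

lemma closedin_colimit_iff:
  "closedin (md_top Y) C \<longleftrightarrow> C \<subseteq> topspace (md_top Y) \<and>
     (\<forall>i<\<kappa>. closedin (md_top (X i)) {x \<in> sp i. h i x \<in> C})"
proof -
  have ope: "openin (md_top Y) U \<longleftrightarrow> U \<subseteq> topspace (md_top Y) \<and>
        (\<forall>i<\<kappa>. openin (md_top (X i)) {x \<in> sp i. h i x \<in> U})" for U
    using cocone by (simp add: colimit_cocone_def md_colimit_def)
  have "{x \<in> sp i. h i x \<in> topspace (md_top Y) - C} = sp i - {x \<in> sp i. h i x \<in> C}" if "i < \<kappa>" for i
    using h_in_topspace[OF that] by auto
  then show ?thesis
    by (auto simp: closedin_def ope)
qed

text \<open>Points identified in the colimit are already identified at some stage. Injectivity below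
  \<kappa> is a premise because the lemma serves as the limit step of the induction in
  \<open>f_inj\<close>.\<close>

lemma colimit_inj:
  assumes "\<And>i j. i \<le> j \<Longrightarrow> j < \<kappa> \<Longrightarrow> inj_on (f i j) (sp i)" and "i < \<kappa>"
  shows "inj_on (h i) (sp i)"
proof (rule inj_onI)
  fix x y assume *: "x \<in> sp i" "y \<in> sp i" "h i x = h i y"
  then obtain k where "k < \<kappa>" "i \<le> k" "f i k x = f i k y"
    using colimit_eqD assms(2) by metis
  then show "x = y"
    using assms(1) * by (meson inj_onD)
qed

text \<open>The image of \<open>C\<close> is tested on every stage \<open>j\<close>: from
  \<open>i\<close> on its trace is the image under \<open>f i j\<close>, a closed map; before
  \<open>i\<close> it is the preimage under \<open>f j i\<close>, a continuous map.\<close>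

lemma colimit_closed_map:
  assumes inj: "\<And>i j. i \<le> j \<Longrightarrow> j < \<kappa> \<Longrightarrow> inj_on (f i j) (sp i)"
    and clo: "\<And>i j. i \<le> j \<Longrightarrow> j < \<kappa> \<Longrightarrow> closed_map (md_top (X i)) (md_top (X j)) (f i j)"
    and i: "i < \<kappa>"
  shows "closed_map (md_top (X i)) (md_top Y) (h i)"
  unfolding closed_map_def
proof (intro allI impI)
  fix C assume C: "closedin (md_top (X i)) C"
  then have CX: "C \<subseteq> sp i"
    by (rule closedin_subset)
  have "closedin (md_top (X j)) {x \<in> sp j. h j x \<in> h i ` C}" if j: "j < \<kappa>" for j
  proof (cases "i \<le> j")
    case True
    have "h i c = h j (f i j c)" "f i j c \<in> sp j" if "c \<in> C" for c
      using h_f[OF True j] f_in_sp[OF True below_lam[OF j]] CX that by auto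
    then have "{x \<in> sp j. h j x \<in> h i ` C} = f i j ` C"
      using colimit_inj[OF inj j] by (auto simp: inj_on_eq_iff)
    then show ?thesis
      using clo[OF True j] C by (simp add: closed_map_def)
  next
    case False
    then have ji: "j \<le> i" by simp
    have "h j x \<in> h i ` C \<longleftrightarrow> f j i x \<in> C" if "x \<in> sp j" for x
      using inj_on_image_mem_iff[OF colimit_inj[OF inj i] f_in_sp[OF ji below_lam[OF i] that] CX]
        h_f[OF ji i that] by simp
    then have "{x \<in> sp j. h j x \<in> h i ` C} = {x \<in> sp j. f j i x \<in> C}"
      by blast
    then show ?thesis
      using closedin_continuous_map_preimage[OF f_continuous[OF ji below_lam[OF i]] C] by simp
  qed
  moreover have "h i ` C \<subseteq> topspace (md_top Y)"
    using CX h_in_topspace[OF i] by blast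
  ultimately show "closedin (md_top Y) (h i ` C)"
    by (simp add: closedin_colimit_iff)
qed

text \<open>The union is already closed under composition, so generation adds nothing: the joining
  points of two composable paths agree at some common stage, and the composite can be formed
  there.\<close>

lemma colimit_paths: "md_paths Y = (\<Union>i\<in>{..<\<kappa>}. pmap (h i) ` md_paths (X i))" (is "_ = ?P")
proof -
  have gen: "md_paths Y = gen_paths ?P"
    using cocone by (simp add: colimit_cocone_def md_colimit_def lessThan_def)
  have pX: "path_closed (md_paths (X i))" if "i < \<kappa>" for i
    using mds[OF below_lam[OF that]] by (simp add: is_mdspace_def)
  have "path_closed ?P"
    unfolding path_closed_def
  proof (intro conjI ballI impI)
    fix \<gamma> \<phi> assume "\<gamma> \<in> ?P" and \<phi>: "\<phi> \<in> reparam"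
    then obtain i \<delta> where i: "i < \<kappa>" and \<delta>: "\<delta> \<in> md_paths (X i)" "\<gamma> = pmap (h i) \<delta>"
      by auto
    then have "restrict (\<gamma> \<circ> \<phi>) {0..1} \<in> pmap (h i) ` md_paths (X i)"
      using pX[OF i] \<phi> by (simp add: pmap_reparam path_closed_def)
    with i show "restrict (\<gamma> \<circ> \<phi>) {0..1} \<in> ?P"
      by blast
  next
    fix \<gamma>1 \<gamma>2 assume "\<gamma>1 \<in> ?P" "\<gamma>2 \<in> ?P" and eq: "\<gamma>1 1 = \<gamma>2 0"
    then obtain i j \<delta>1 \<delta>2 where ij: "i < \<kappa>" "j < \<kappa>"
      and \<delta>: "\<delta>1 \<in> md_paths (X i)" "\<gamma>1 = pmap (h i) \<delta>1" "\<delta>2 \<in> md_paths (X j)" "\<gamma>2 = pmap (h j) \<delta>2"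
      by auto
    have d: "\<delta>1 t \<in> sp i" "\<delta>2 t \<in> sp j" if "t \<in> {0..1}" for t
      using \<delta> ij that by (auto intro!: mdspace_path_in_topspace mds below_lam)
    have "h i (\<delta>1 1) = h j (\<delta>2 0)"
      using eq \<delta> by simp
    then obtain k where k: "k < \<kappa>" "i \<le> k" "j \<le> k" "f i k (\<delta>1 1) = f j k (\<delta>2 0)"
      using colimit_eqD[OF ij, of "\<delta>1 1" "\<delta>2 0"] d by auto
    have "pmap (f i k) \<delta>1 \<in> md_paths (X k)" "pmap (f j k) \<delta>2 \<in> md_paths (X k)"
      using maps[OF k(2) below_lam[OF k(1)]] maps[OF k(3) below_lam[OF k(1)]] \<delta>
      by (auto simp: md_map_def)
    then have "ncomp (pmap (f i k) \<delta>1) (pmap (f j k) \<delta>2) \<in> md_paths (X k)"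
      using pX[OF k(1)] k(4) by (simp add: path_closed_def)
    moreover have "\<gamma>1 = pmap (h k) (pmap (f i k) \<delta>1)" "\<gamma>2 = pmap (h k) (pmap (f j k) \<delta>2)"
      unfolding \<delta> using d by (auto intro!: pmap_cong simp: h_f k)
    ultimately have "ncomp \<gamma>1 \<gamma>2 \<in> pmap (h k) ` md_paths (X k)"
      by (simp add: pmap_ncomp)
    with k(1) show "ncomp \<gamma>1 \<gamma>2 \<in> ?P"
      by blast
  qed
  then show ?thesis
    using gen gen_paths_superset[of ?P] gen_paths_induct[of _ ?P ?P] by blast
qed

lemma colimit_path_stage:
  assumes "\<gamma> \<in> md_paths Y" "i < \<kappa>"
  obtains k \<delta> where "i \<le> k" "k < \<kappa>" "\<delta> \<in> md_paths (X k)" "\<gamma> = pmap (h k) \<delta>"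
proof -
  obtain j \<epsilon> where j: "j < \<kappa>" "\<epsilon> \<in> md_paths (X j)" "\<gamma> = pmap (h j) \<epsilon>"
    using assms(1) by (auto simp: colimit_paths)
  define k where "k = max i j"
  have k: "i \<le> k" "j \<le> k" "k < \<kappa>"
    using assms(2) j by (auto simp: k_def)
  have "pmap (f j k) \<epsilon> \<in> md_paths (X k)"
    using maps[OF k(2) below_lam[OF k(3)]] j by (auto simp: md_map_def)
  moreover have "\<gamma> = pmap (h k) (pmap (f j k) \<epsilon>)"
    unfolding j using j mds[OF below_lam[OF j(1)]]
    by (auto intro!: pmap_cong simp: h_f k mdspace_path_in_topspace)
  ultimately show ?thesis
    using that k by blast
qed

end

section \<open>Embeddings and path reflection by transfinite induction\<close>

lemma f_inj: "i \<le> j \<Longrightarrow> j < lam \<Longrightarrow> inj_on (f i j) (sp i)"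
proof (induction j arbitrary: i rule: less_induct)
  case (less j)
  show ?case
  proof (cases "i = j")
    case True
    then show ?thesis
      using less.prems fid by (simp add: inj_on_def)
  next
    case False
    then have ij: "i < j" using less.prems by simp
    show ?thesis
    proof (cases j rule: wellorder_trichotomy)
      case 1
      then show ?thesis using ij by (simp add: is_least_def)
    next
      case (2 k)
      have k: "i \<le> k" "k < j"
        using is_succ_lessD[OF 2 ij] is_succ_less[OF 2] .
      then have klam: "k < lam"
        using less.prems(2) by (blast intro: less_trans)
      obtain n g gh where "glob_pushout n g (X k) (X j) (f k j) gh"
        using succ[OF less.prems(2) 2] by blast
      then have "inj_on (f k j) (f i k ` sp i)"
        by (rule inj_on_subset[OF glob_pushout_inj]) (use k klam f_in_sp in blast)
      then have "inj_on (f k j \<circ> f i k) (sp i)"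
        using less.IH[OF k(2,1) klam] comp_inj_on by blast
      moreover have "(f k j \<circ> f i k) x = f i j x" if "x \<in> sp i" for x
        using fcomp[OF k(1) less_imp_le[OF k(2)] less.prems(2) that] by simp
      ultimately show ?thesis
        by (simp cong: inj_on_cong)
    next
      case 3
      show ?thesis
        by (rule colimit_inj[OF colimit_cocone_limit[OF less.prems(2) 3] _ ij])
          (meson less.IH less.prems(2) less_trans)
    qed
  qed
qed

lemma f_closed_map: "i \<le> j \<Longrightarrow> j < lam \<Longrightarrow> closed_map (md_top (X i)) (md_top (X j)) (f i j)"
proof (induction j arbitrary: i rule: less_induct)
  case (less j)
  show ?case
  proof (cases "i = j")
    case True
    have "closed_map (md_top (X j)) (md_top (X j)) (f j j)"
      by (rule closed_map_eq[where f = id]) (simp_all add: closed_map_id fid less.prems(2))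
    with True show ?thesis
      by simp
  next
    case False
    then have ij: "i < j" using less.prems by simp
    show ?thesis
    proof (cases j rule: wellorder_trichotomy)
      case 1
      then show ?thesis using ij by (simp add: is_least_def)
    next
      case (2 k)
      have k: "i \<le> k" "k < j"
        using is_succ_lessD[OF 2 ij] is_succ_less[OF 2] .
      then have klam: "k < lam"
        using less.prems(2) by (blast intro: less_trans)
      obtain n g gh where "glob_pushout n g (X k) (X j) (f k j) gh"
        using succ[OF less.prems(2) 2] by blast
      then have "closed_map (md_top (X i)) (md_top (X j)) (f k j \<circ> f i k)"
        using less.IH[OF k(2,1) klam] glob_pushout_closed_map closed_map_compose by blast
      moreover have "(f k j \<circ> f i k) x = f i j x" if "x \<in> sp i" for x
        using fcomp[OF k(1) less_imp_le[OF k(2)] less.prems(2) that] by simp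
      ultimately show ?thesis
        by (rule closed_map_eq)
    next
      case 3
      show ?thesis
        by (rule colimit_closed_map[OF colimit_cocone_limit[OF less.prems(2) 3] _ _ ij])
          (meson less.IH f_inj less.prems(2) less_trans)+
    qed
  qed
qed

lemma f_path_reflect:
  "\<lbrakk>i \<le> j; j < lam; \<gamma> \<in> md_paths (X j); \<gamma> ` {0..1} \<subseteq> f i j ` sp i\<rbrakk> \<Longrightarrow> \<gamma> \<in> pmap (f i j) ` md_paths (X i)"
proof (induction j arbitrary: i \<gamma> rule: less_induct)
  case (less j)
  note ij = less.prems(1) and j = less.prems(2) and \<gamma> = less.prems(3,4)
  \<comment> \<open>Common to successor and limit stages: once the path comes from a stage
    \<open>k\<close> strictly below \<open>j\<close>, injectivity of \<open>f k j\<close> places the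
    lift in the image of \<open>sp i\<close>, and the induction hypothesis for \<open>k\<close>
    applies.\<close>
  have descend: "\<gamma> \<in> pmap (f i j) ` md_paths (X i)"
    if k: "i \<le> k" "k < j" and \<delta>: "\<delta> \<in> md_paths (X k)" "\<gamma> = pmap (f k j) \<delta>" for k \<delta>
  proof -
    have klam: "k < lam" using k j by simp
    have \<delta>in: "\<delta> t \<in> sp k" if "t \<in> {0..1}" for t
      using mdspace_path_in_topspace[OF mds[OF klam] \<delta>(1) that] .
    have "\<delta> t \<in> f i k ` sp i" if t: "t \<in> {0..1}" for t
    proof -
      obtain x where x: "x \<in> sp i" "\<gamma> t = f i j x"
        using \<gamma>(2) t by blast
      then have "f k j (\<delta> t) = f k j (f i k x)"
        using \<delta>(2) t fcomp[of i k j x] k j by simp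
      then have "\<delta> t = f i k x"
        using f_inj[OF less_imp_le[OF k(2)] j] \<delta>in[OF t] f_in_sp[OF k(1) klam x(1)] by (simp add: inj_on_eq_iff)
      with x show ?thesis by blast
    qed
    then have "\<delta> \<in> pmap (f i k) ` md_paths (X i)"
      using less.IH[OF k(2,1) klam \<delta>(1)] by blast
    then obtain \<epsilon> where \<epsilon>: "\<epsilon> \<in> md_paths (X i)" "\<delta> = pmap (f i k) \<epsilon>"
      by blast
    have "\<epsilon> t \<in> sp i" if "t \<in> {0..1}" for t
      using k klam by (intro mdspace_path_in_topspace[OF mds \<epsilon>(1) that]) simp
    then have "\<gamma> = pmap (f i j) \<epsilon>"
      unfolding \<delta>(2) \<epsilon>(2) using k j by (intro pmap_cong) (simp add: fcomp[of i k j])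
    with \<epsilon>(1) show ?thesis by blast
  qed
  show ?case
  proof (cases "i = j")
    case True
    \<comment> \<open>Extensionality is what makes the path equal to its image under
      \<open>pmap (f j j)\<close> outside the interval as well.\<close>
    have "\<gamma> \<in> extensional {0..1}"
      using mds[OF j] \<gamma>(1) by (auto simp: is_mdspace_def cpaths_def)
    moreover have "\<gamma> t = pmap (f j j) \<gamma> t" if "t \<in> {0..1}" for t
      using fid[OF j] mdspace_path_in_topspace[OF mds[OF j] \<gamma>(1)] that by simp
    ultimately have "\<gamma> = pmap (f j j) \<gamma>"
      by (intro extensionalityI[of _ "{0..1}"]) (auto simp: pmap_def)
    then show ?thesis
      using True \<gamma>(1) by blast
  next
    case False
    then have less_ij: "i < j" using ij by simp
    show ?thesis
    proof (cases j rule: wellorder_trichotomy)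
      case 1
      then show ?thesis using less_ij by (simp add: is_least_def)
    next
      case (2 k)
      have k: "i \<le> k" "k < j"
        using is_succ_lessD[OF 2 less_ij] is_succ_less[OF 2] .
      then have klam: "k < lam"
        using j by (blast intro: less_trans)
      obtain n g gh where P: "glob_pushout n g (X k) (X j) (f k j) gh"
        using succ[OF j 2] by blast
      have "f i j ` sp i \<subseteq> f k j ` sp k"
        using fcomp[of i k j] f_in_sp[of i k] k klam j by (auto simp: image_subset_iff)
      then have "\<gamma> \<in> pmap (f k j) ` md_paths (X k)"
        using glob_pushout_path_reflect[OF P mds[OF klam] \<gamma>(1)] \<gamma>(2) by blast
      then show ?thesis
        using descend k by blast
    next
      case 3
      show ?thesis
        using colimit_path_stage[OF colimit_cocone_limit[OF j 3] \<gamma>(1) less_ij] descend by metis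
    qed
  qed
qed

section \<open>Cocone maps, compact subsets and plots of the colimit\<close>

context
  fixes \<kappa> Y h
  assumes cocone: "colimit_cocone \<kappa> Y h"
begin

lemma h_inj: "i < \<kappa> \<Longrightarrow> inj_on (h i) (sp i)"
  by (rule colimit_inj[OF cocone]) (simp_all add: f_inj below_lam[OF cocone])

lemma h_closed_map: "i < \<kappa> \<Longrightarrow> closed_map (md_top (X i)) (md_top Y) (h i)"
  by (rule colimit_closed_map[OF cocone]) (simp_all add: f_inj f_closed_map below_lam[OF cocone])

text \<open>The path comes from some stage \<open>k\<close> at or above \<open>i\<close>;
  injectivity of \<open>h k\<close> puts the lift into the image of \<open>sp i\<close>, and
  \<open>f_path_reflect\<close> brings it down.\<close>

lemma h_path_reflect:
  assumes i: "i < \<kappa>" and \<gamma>: "\<gamma> \<in> md_paths Y" "\<gamma> ` {0..1} \<subseteq> h i ` sp i"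
  shows "\<gamma> \<in> pmap (h i) ` md_paths (X i)"
proof -
  obtain k \<delta> where k: "i \<le> k" "k < \<kappa>" and \<delta>: "\<delta> \<in> md_paths (X k)" "\<gamma> = pmap (h k) \<delta>"
    using colimit_path_stage[OF cocone \<gamma>(1) i] .
  have klam: "k < lam" using below_lam[OF cocone k(2)] .
  have "\<delta> t \<in> f i k ` sp i" if t: "t \<in> {0..1}" for t
  proof -
    obtain x where x: "x \<in> sp i" "\<gamma> t = h i x"
      using \<gamma>(2) t by blast
    then have "h k (\<delta> t) = h k (f i k x)"
      using \<delta>(2) t h_f[OF cocone k x(1)] by simp
    then have "\<delta> t = f i k x"
      using h_inj[OF k(2)] mdspace_path_in_topspace[OF mds[OF klam] \<delta>(1) t]
        f_in_sp[OF k(1) klam x(1)] by (simp add: inj_on_eq_iff)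
    with x show ?thesis by blast
  qed
  then have "\<delta> \<in> pmap (f i k) ` md_paths (X i)"
    by (intro f_path_reflect[OF k(1) klam \<delta>(1)]) blast
  then obtain \<epsilon> where \<epsilon>: "\<epsilon> \<in> md_paths (X i)" "\<delta> = pmap (f i k) \<epsilon>"
    by blast
  have "\<epsilon> t \<in> sp i" if "t \<in> {0..1}" for t
    using mdspace_path_in_topspace[OF mds[OF below_lam[OF cocone i]] \<epsilon>(1) that] .
  then have "\<gamma> = pmap (h i) \<epsilon>"
    unfolding \<delta>(2) \<epsilon>(2) by (intro pmap_cong) (simp add: h_f[OF cocone k])
  with \<epsilon>(1) show ?thesis by blast
qed

text \<open>The premise allows \<open>T\<close> one point in each open cell. The initial stage is
  discrete, a successor adds at most one point to the trace of \<open>T\<close>, and a limit stage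
  has the final topology.\<close>

lemma sparse_closedin_stage:
  assumes T: "\<And>\<mu> \<nu> x y. \<lbrakk>is_succ \<mu> \<nu>; \<nu> < \<kappa>; x \<in> T \<inter> h \<nu> ` sp \<nu> - h \<mu> ` sp \<mu>;
      y \<in> T \<inter> h \<nu> ` sp \<nu> - h \<mu> ` sp \<mu>\<rbrakk> \<Longrightarrow> x = y"
  shows "j < \<kappa> \<Longrightarrow> closedin (md_top (X j)) {x \<in> sp j. h j x \<in> T}"
proof (induction j rule: less_induct)
  case (less j)
  note j = less.prems
  have jlam: "j < lam" using below_lam[OF cocone j] .
  let ?C = "{x \<in> sp j. h j x \<in> T}"
  have pre: "{x \<in> sp i. f i j x \<in> ?C} = {x \<in> sp i. h i x \<in> T}" if "i < j" for i
    using h_f[OF cocone less_imp_le[OF that] j] f_in_sp[OF less_imp_le[OF that] jlam] by auto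
  show ?case
  proof (cases j rule: wellorder_trichotomy)
    case 1
    then obtain E where "X j = md_set E"
      using zero[OF jlam] by blast
    then show ?thesis
      by (simp add: md_set_def)
  next
    case (2 k)
    note k = is_succ_less[OF 2]
    have IH: "closedin (md_top (X k)) {x \<in> sp k. h k x \<in> T}"
      using less.IH[OF k] k j by (blast intro: less_trans)
    obtain n g gh where P: "glob_pushout n g (X k) (X j) (f k j) gh"
      using succ[OF jlam 2] by blast
    let ?A = "glob_carrier (sphere_m1 n)" let ?B = "glob_carrier (disk n)"
    have AB: "?A \<subseteq> ?B"
      using glob_carrier_mono[OF sphere_subset_disk] .
    have ghB: "gh b \<in> sp j" if "b \<in> ?B" for b
      using P that by (auto simp: glob_pushout_def Let_def)
    have cell: "h j (gh b) \<in> h j ` sp j - h k ` sp k" if b: "b \<in> ?B - ?A" for b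
    proof -
      have "h j (gh b) \<noteq> h k x" if x: "x \<in> sp k" for x
      proof
        assume "h j (gh b) = h k x"
        then have "h j (gh b) = h j (f k j x)"
          using h_f[OF cocone less_imp_le[OF k] j x] by simp
        then have "gh b = f k j x"
          using h_inj[OF j] ghB b f_in_sp[OF less_imp_le[OF k] jlam x] by (simp add: inj_on_eq_iff)
        then show False
          using glob_pushout_cell_disjoint[OF P b] x by blast
      qed
      with ghB b show ?thesis by blast
    qed
    \<comment> \<open>The boundary part is controlled by the previous stage through
      \<open>g\<close>; the part in the open cell has at most one point.\<close>
    have "closedin (glob_top (disk n)) ({a \<in> ?A. g a \<in> {x \<in> sp k. h k x \<in> T}} \<union>
        {b \<in> ?B - ?A. h j (gh b) \<in> T})"
    proof (rule closedin_Un)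
      show "closedin (glob_top (disk n)) {a \<in> ?A. g a \<in> {x \<in> sp k. h k x \<in> T}}"
        using closedin_glob_attaching[OF P IH] .
      show "closedin (glob_top (disk n)) {b \<in> ?B - ?A. h j (gh b) \<in> T}" (is "closedin _ ?D")
      proof (cases "?D = {}")
        case True
        then show ?thesis by (simp only: closedin_empty)
      next
        case False
        then obtain b where b: "b \<in> ?D" by blast
        have "c = b" if c: "c \<in> ?D" for c
        proof -
          have "h j (gh c) = h j (gh b)"
            using T[OF 2 j, of "h j (gh c)" "h j (gh b)"] cell[of b] cell[of c] b c by blast
          then have "gh c = gh b"
            using h_inj[OF j] ghB b c by (simp add: inj_on_eq_iff)
          moreover have "inj_on gh (?B - ?A)"
            using P by (simp add: glob_pushout_def Let_def)
          ultimately show ?thesis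
            using b c by (auto simp: inj_on_eq_iff)
        qed
        with b have "?D = {b}" by blast
        moreover have "b \<in> ?B - {Inl False, Inl True}"
          using b by (auto simp: glob_carrier_def)
        ultimately show ?thesis
          by (simp only: closedin_glob_singleton)
      qed
    qed
    also have "{a \<in> ?A. g a \<in> {x \<in> sp k. h k x \<in> T}} \<union> {b \<in> ?B - ?A. h j (gh b) \<in> T} =
        {b \<in> ?B. gh b \<in> ?C}"
    proof -
      have "gh a \<in> ?C \<longleftrightarrow> g a \<in> {x \<in> sp k. h k x \<in> T}" if "a \<in> ?A" for a
        using glob_attaching_in_topspace[OF P that] h_f[OF cocone less_imp_le[OF k] j]
          f_in_sp[OF less_imp_le[OF k] jlam] by auto
      then show ?thesis
        using AB ghB by blast
    qed
    finally show ?thesis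
      by (intro closedin_pushoutI[OF P]) (use IH in \<open>auto simp only: pre[OF k]\<close>)
  next
    case 3
    have "closedin (md_top (X i)) {x \<in> sp i. f i j x \<in> ?C}" if "i < j" for i
      unfolding pre[OF that] using less.IH[OF that] that j by (blast intro: less_trans)
    then show ?thesis
      unfolding closedin_colimit_iff[OF colimit_cocone_limit[OF jlam 3]] by blast
  qed
qed

text \<open>Picking one point of \<open>K\<close> in each stage at which \<open>K\<close> acquires new points gives a set all of
  whose subsets are closed, which must be finite by compactness.\<close>

lemma compactin_colimit_stage:
  assumes K: "compactin (md_top Y) K" "K \<noteq> {}"
  obtains i where "i < \<kappa>" "K \<subseteq> h i ` sp i"
proof -
  have KY: "K \<subseteq> topspace (md_top Y)"
    using compactin_subset_topspace[OF K(1)] .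
  define rk where "rk x = (LEAST i. i < \<kappa> \<and> x \<in> h i ` sp i)" for x
  have rk: "rk x < \<kappa> \<and> x \<in> h (rk x) ` sp (rk x)" if "x \<in> K" for x
  proof -
    have "\<exists>i. i < \<kappa> \<and> x \<in> h i ` sp i"
      using that KY unfolding colimit_topspace[OF cocone] by blast
    then show ?thesis
      unfolding rk_def by (rule LeastI_ex)
  qed
  \<comment> \<open>A point that is new at a successor stage has that stage as its rank, so a set on
    which \<open>rk\<close> is injective has at most one point in each open cell.\<close>
  have rk_succ: "rk x = \<nu>" if s: "is_succ \<mu> \<nu>" "\<nu> < \<kappa>" and x: "x \<in> h \<nu> ` sp \<nu> - h \<mu> ` sp \<mu>" for x \<mu> \<nu>
    unfolding rk_def
  proof (rule Least_equality)
    show "\<nu> < \<kappa> \<and> x \<in> h \<nu> ` sp \<nu>"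
      using s x by blast
    fix i assume i: "i < \<kappa> \<and> x \<in> h i ` sp i"
    show "\<nu> \<le> i"
    proof (rule ccontr)
      assume "\<not> \<nu> \<le> i"
      then have "i \<le> \<mu>"
        using is_succ_lessD[OF s(1)] by simp
      moreover have "\<mu> < \<kappa>"
        using is_succ_less[OF s(1)] s(2) by (rule less_trans)
      ultimately show False
        using h_image_mono[OF cocone, of i \<mu>] i x by blast
    qed
  qed
  obtain A where A: "A \<subseteq> K" "inj_on rk A" "rk ` K = rk ` A"
    by (metis subset_image_inj subset_refl)
  have closed: "closedin (md_top Y) T" if TA: "T \<subseteq> A" for T
    unfolding closedin_colimit_iff[OF cocone]
  proof (intro conjI allI impI)
    show "T \<subseteq> topspace (md_top Y)"
      using TA A(1) KY by blast
    fix i assume "i < \<kappa>"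
    then show "closedin (md_top (X i)) {x \<in> sp i. h i x \<in> T}"
    proof (rule sparse_closedin_stage[rotated])
      fix \<mu> \<nu> x y
      assume s: "is_succ \<mu> \<nu>" "\<nu> < \<kappa>" and xy: "x \<in> T \<inter> h \<nu> ` sp \<nu> - h \<mu> ` sp \<mu>"
        "y \<in> T \<inter> h \<nu> ` sp \<nu> - h \<mu> ` sp \<mu>"
      then have "rk x = rk y"
        using rk_succ[OF s, of x] rk_succ[OF s, of y] by simp
      then show "x = y"
        using xy TA A(2) by (meson DiffD1 IntD1 inj_onD subsetD)
    qed
  qed
  have "finite A"
  proof (rule ccontr)
    assume "infinite A"
    then obtain x where x: "x \<in> md_top Y derived_set_of A"
      using compactin_imp_Bolzano_Weierstrass[OF K(1)] A(1) by blast
    then have xY: "x \<in> topspace (md_top Y)"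
      and acc: "\<And>U. x \<in> U \<Longrightarrow> openin (md_top Y) U \<Longrightarrow> \<exists>y. y \<noteq> x \<and> y \<in> A \<and> y \<in> U"
      by (simp_all add: derived_set_of_def)
    \<comment> \<open>The complement of this closed set is a neighbourhood of \<open>x\<close> with
      no other point of \<open>A\<close>, so \<open>x\<close> cannot be an accumulation
      point.\<close>
    have "closedin (md_top Y) (A - {x})"
      by (rule closed) blast
    then have "openin (md_top Y) (topspace (md_top Y) - (A - {x}))"
      by (simp add: closedin_def)
    from acc[OF _ this] xY show False
      by blast
  qed
  then have fin: "finite (rk ` K)" "rk ` K \<noteq> {}"
    using A(3) K(2) by auto
  define i where "i = Max (rk ` K)"
  have "i \<in> rk ` K"
    unfolding i_def using fin by (rule Max_in)
  then have i: "i < \<kappa>"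
    using rk by auto
  have "x \<in> h i ` sp i" if "x \<in> K" for x
    using rk[OF that] h_image_mono[OF cocone, of "rk x" i] i fin(1) that by (auto simp: i_def)
  with i that show ?thesis by blast
qed

text \<open>Compactness of the image of the adjoint yields a stage and a set-theoretic lift; the
  closed embedding \<open>h i\<close> makes this lift continuous.\<close>

lemma path_plot_lift:
  assumes g: "path_plot n (md_top Y) g"
  obtains i g' where "i < \<kappa>" "path_plot n (md_top (X i)) g'"
    "\<And>x. x \<in> standard_simplex n \<Longrightarrow> g x = pmap (h i) (g' x)"
proof -
  let ?P = "prod_topology (simplex_top n) unit_top"
  let ?G = "\<lambda>p. g (fst p) (snd p)"
  have G: "continuous_map ?P (md_top Y) ?G"
    using g by (simp add: path_plot_def)
  have "compact_space ?P"
    by (simp add: compact_space_prod_topology compact_space_simplex_top compact_space_unit_top)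
  then have "compactin (md_top Y) (?G ` topspace ?P)"
    using G image_compactin compact_space_def by blast
  \<comment> \<open>Nonemptiness ensures that there is a stage at all: \<kappa> may be the least
    index.\<close>
  moreover have "?G ` topspace ?P \<noteq> {}"
    using nonempty_standard_simplex by auto
  ultimately obtain i where i: "i < \<kappa>" and im: "?G ` topspace ?P \<subseteq> h i ` sp i"
    by (rule compactin_colimit_stage)
  define r where "r = inv_into (sp i) (h i)"
  have r: "r y \<in> sp i" "h i (r y) = y" if "y \<in> h i ` sp i" for y
    using that by (auto simp: r_def inv_into_into f_inv_into_f)
  have gin: "g x t \<in> h i ` sp i" if "x \<in> standard_simplex n" "t \<in> {0..1}" for x t
  proof -
    have "?G (x, t) \<in> ?G ` topspace ?P"
      using that by (intro imageI) simp
    with im show ?thesis by auto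
  qed
  define g' where "g' x = restrict (\<lambda>t. r (g x t)) {0..1}" for x
  \<comment> \<open>The preimage under \<open>r\<close> of a closed set is its image under the
    closed map \<open>h i\<close>.\<close>
  have cont_r: "continuous_map (subtopology (md_top Y) (h i ` sp i)) (md_top (X i)) r"
    unfolding continuous_map_closedin
  proof (intro conjI allI impI)
    show "r \<in> topspace (subtopology (md_top Y) (h i ` sp i)) \<rightarrow> sp i"
      using r(1) by auto
  next
    fix C assume C: "closedin (md_top (X i)) C"
    then have CX: "C \<subseteq> sp i" by (rule closedin_subset)
    have "{y \<in> topspace (subtopology (md_top Y) (h i ` sp i)). r y \<in> C} = h i ` C"
    proof -
      have "h i x \<in> topspace (md_top Y) \<and> h i x \<in> h i ` sp i \<and> r (h i x) = x" if "x \<in> C" for x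
        using h_in_topspace[OF cocone i] h_inj[OF i] CX that by (auto simp: r_def)
      moreover have "y \<in> h i ` C" if "y \<in> h i ` sp i" "r y \<in> C" for y
        using imageI[OF that(2), of "h i"] r(2)[OF that(1)] by simp
      ultimately show ?thesis
        unfolding topspace_subtopology by (intro subset_antisym subsetI) auto
    qed
    moreover have "closedin (md_top Y) (h i ` C)"
      using h_closed_map[OF i] C by (simp add: closed_map_def)
    moreover have "h i ` C \<subseteq> h i ` sp i"
      using CX by blast
    ultimately show "closedin (subtopology (md_top Y) (h i ` sp i))
        {y \<in> topspace (subtopology (md_top Y) (h i ` sp i)). r y \<in> C}"
      by (simp add: closedin_subset_topspace)
  qed
  have "continuous_map ?P (subtopology (md_top Y) (h i ` sp i)) ?G"
    using G im by (auto simp: continuous_map_in_subtopology)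
  from continuous_map_compose[OF this cont_r]
  have cont: "continuous_map ?P (md_top (X i)) (\<lambda>p. g' (fst p) (snd p))"
    by (rule continuous_map_eq) (auto simp: g'_def)
  moreover have "g' x \<in> cpaths (md_top (X i))" if x: "x \<in> standard_simplex n" for x
  proof -
    have "continuous_map unit_top ?P (\<lambda>t. (x, t))"
      using x by (simp add: continuous_map_pairwise o_def)
    from continuous_map_compose[OF this cont]
    have "continuous_map unit_top (md_top (X i)) (g' x)"
      by (simp add: o_def)
    moreover have "g' x \<in> extensional {0..1}"
      by (simp add: g'_def)
    ultimately show ?thesis
      by (simp add: cpaths_def)
  qed
  ultimately have "path_plot n (md_top (X i)) g'"
    by (simp add: path_plot_def)
  moreover have "g x = pmap (h i) (g' x)" if x: "x \<in> standard_simplex n" for x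
  proof (rule extensionalityI[of _ "{0..1}"])
    show "g x \<in> extensional {0..1}"
      using g x by (simp add: path_plot_def cpaths_def)
    show "g x t = pmap (h i) (g' x) t" if "t \<in> {0..1}" for t
      using r(2)[OF gin[OF x that]] that by (simp add: g'_def)
  qed (simp add: pmap_def)
  ultimately show ?thesis
    using that i by blast
qed

text \<open>Open sets pull back to each stage because \<open>h i\<close> carries plots to plots.
  Conversely, a plot of execution paths of \<open>Y\<close> with fixed endpoints lifts to such a
  plot of a single stage, where openness is given.\<close>

lemma exec_paths_colimit:
  "top_colimit {\<nu>. \<nu> < \<kappa>} (\<lambda>\<nu>. exec_top (X \<nu>)) (\<lambda>\<mu> \<rho>. pmap (f \<mu> \<rho>)) (exec_top Y) (\<lambda>\<nu>. pmap (h \<nu>))"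
proof -
  have Y: "is_mdspace Y"
    using cocone by (simp add: colimit_cocone_def)
  have mdX: "is_mdspace (X i)" if "i < \<kappa>" for i
    using mds below_lam[OF cocone that] by blast
  have hmap: "md_map (X i) Y (h i)" if "i < \<kappa>" for i
    using cocone that by (simp add: colimit_cocone_def)
  have eqD: "\<exists>k\<in>{\<nu>. \<nu> < \<kappa>}. i \<le> k \<and> j \<le> k \<and> pmap (f i k) \<gamma> = pmap (f j k) \<delta>"
    if ij: "i < \<kappa>" "j < \<kappa>" and p: "\<gamma> \<in> md_paths (X i)" "\<delta> \<in> md_paths (X j)"
      and eq: "pmap (h i) \<gamma> = pmap (h j) \<delta>" for i j \<gamma> \<delta>
  proof -
    \<comment> \<open>The colimit alone would give a stage depending on the time \<open>t\<close>;
      injectivity of \<open>h k\<close> makes this one stage work for all \<open>t\<close>.\<close>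
    define k where "k = max i j"
    have k: "i \<le> k" "j \<le> k" "k < \<kappa>"
      using ij by (auto simp: k_def)
    note klam = below_lam[OF cocone k(3)]
    have "f i k (\<gamma> t) = f j k (\<delta> t)" if t: "t \<in> {0..1}" for t
    proof -
      have in_sp: "\<gamma> t \<in> sp i" "\<delta> t \<in> sp j"
        using mdspace_path_in_topspace[OF mdX] ij p t by auto
      have "h i (\<gamma> t) = h j (\<delta> t)"
        using fun_cong[OF eq, of t] t by simp
      then have "h k (f i k (\<gamma> t)) = h k (f j k (\<delta> t))"
        using h_f[OF cocone k(1,3) in_sp(1)] h_f[OF cocone k(2,3) in_sp(2)] by simp
      then show ?thesis
        using h_inj[OF k(3)] f_in_sp[OF k(1) klam in_sp(1)] f_in_sp[OF k(2) klam in_sp(2)]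
        by (simp add: inj_on_eq_iff)
    qed
    then have "pmap (f i k) \<gamma> = pmap (f j k) \<delta>"
      by (rule pmap_cong)
    with k show ?thesis by blast
  qed
  have "openin (exec_top (X i)) {\<gamma> \<in> md_paths (X i). pmap (h i) \<gamma> \<in> U}"
    if U: "openin (exec_top Y) U" and i: "i < \<kappa>" for U i
    unfolding openin_exec_top[OF mdX[OF i]]
  proof (intro conjI ballI allI impI)
    fix a b n g
    assume ab: "a \<in> md_states (X i)" "b \<in> md_states (X i)" and g: "path_plot n (md_top (X i)) g"
      and im: "g ` standard_simplex n \<subseteq> exec_paths_ab (X i) a b"
    have "h i a \<in> md_states Y" "h i b \<in> md_states Y"
      using hmap[OF i] ab by (auto simp: md_map_def)
    moreover have "path_plot n (md_top Y) (\<lambda>x. pmap (h i) (g x))"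
      using path_plot_pmap[OF g h_continuous[OF cocone i]] .
    moreover have "(\<lambda>x. pmap (h i) (g x)) ` standard_simplex n \<subseteq> exec_paths_ab Y (h i a) (h i b)"
      using im hmap[OF i] by (auto simp: exec_paths_ab_def md_map_def image_subset_iff)
    ultimately have "openin (simplex_top n) {x \<in> standard_simplex n. pmap (h i) (g x) \<in> U}"
      using U unfolding openin_exec_top[OF Y] by blast
    also have "{x \<in> standard_simplex n. pmap (h i) (g x) \<in> U} =
        {x \<in> standard_simplex n. g x \<in> {\<gamma> \<in> md_paths (X i). pmap (h i) \<gamma> \<in> U}}"
      using im by (auto simp: exec_paths_ab_def)
    finally show "openin (simplex_top n)
        {x \<in> standard_simplex n. g x \<in> {\<gamma> \<in> md_paths (X i). pmap (h i) \<gamma> \<in> U}}" .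
  qed blast
  moreover have "openin (exec_top Y) U"
    if U: "U \<subseteq> md_paths Y"
      and op: "\<And>i. i < \<kappa> \<Longrightarrow> openin (exec_top (X i)) {\<gamma> \<in> md_paths (X i). pmap (h i) \<gamma> \<in> U}" for U
    unfolding openin_exec_top[OF Y]
  proof (intro conjI ballI allI impI)
    fix a b n g
    assume g: "path_plot n (md_top Y) g" and im: "g ` standard_simplex n \<subseteq> exec_paths_ab Y a b"
    obtain i g' where i: "i < \<kappa>" and g': "path_plot n (md_top (X i)) g'"
      and eq: "\<And>x. x \<in> standard_simplex n \<Longrightarrow> g x = pmap (h i) (g' x)"
      using path_plot_lift[OF g] by blast
    have g'top: "g' x t \<in> sp i" if "x \<in> standard_simplex n" "t \<in> {0..1}" for x t
    proof -
      have "continuous_map unit_top (md_top (X i)) (g' x)"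
        using g' that(1) by (simp add: path_plot_def cpaths_def)
      from continuous_map_funspace[OF this] that(2) show ?thesis by auto
    qed
    \<comment> \<open>The lift consists so far of continuous paths only. Reflection supplies an
      execution path over \<open>g x\<close>, and injectivity of \<open>h i\<close> identifies it
      with \<open>g' x\<close>.\<close>
    have g'path: "g' x \<in> md_paths (X i)" if x: "x \<in> standard_simplex n" for x
    proof -
      have "g x \<in> md_paths Y"
        using im x by (auto simp: exec_paths_ab_def)
      moreover have "g x ` {0..1} \<subseteq> h i ` sp i"
        using g'top[OF x] by (auto simp: eq[OF x])
      ultimately obtain \<delta> where \<delta>: "\<delta> \<in> md_paths (X i)" "g x = pmap (h i) \<delta>"
        using h_path_reflect[OF i] by blast
      have "g' x t = \<delta> t" if t: "t \<in> {0..1}" for t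
      proof -
        have "h i (g' x t) = h i (\<delta> t)"
          using fun_cong[OF trans[OF eq[OF x, symmetric] \<delta>(2)], of t] t by simp
        then show ?thesis
          using h_inj[OF i] g'top[OF x t] mdspace_path_in_topspace[OF mdX[OF i] \<delta>(1) t]
          by (simp add: inj_on_eq_iff)
      qed
      moreover have "g' x \<in> extensional {0..1}"
        using g' x by (simp add: path_plot_def cpaths_def)
      moreover have "\<delta> \<in> extensional {0..1}"
        using mdX[OF i] \<delta>(1) by (auto simp: is_mdspace_def cpaths_def)
      ultimately have "g' x = \<delta>"
        by (intro extensionalityI[of _ "{0..1}"])
      with \<delta>(1) show ?thesis by simp
    qed
    obtain x0 where x0: "x0 \<in> standard_simplex n"
      using nonempty_standard_simplex by blast
    \<comment> \<open>The topology of the stage is tested only on plots with common endpoints;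
      injectivity of \<open>h i\<close> transfers this from \<open>g\<close> to
      \<open>g'\<close>.\<close>
    have ends: "g' x t = g' x0 t" if "x \<in> standard_simplex n" "t \<in> {0, 1}" for x t
    proof -
      have "g x t = g x0 t"
        using im that x0 by (auto simp: exec_paths_ab_def image_subset_iff)
      moreover have "t \<in> {0..1}"
        using that(2) by auto
      ultimately show ?thesis
        using h_inj[OF i] g'top that(1) x0 by (simp add: eq inj_on_eq_iff)
    qed
    have "g' x0 0 \<in> md_states (X i)" "g' x0 1 \<in> md_states (X i)"
      using mdX[OF i] g'path[OF x0] by (auto simp: is_mdspace_def)
    moreover have "g' ` standard_simplex n \<subseteq> exec_paths_ab (X i) (g' x0 0) (g' x0 1)"
      using g'path ends by (auto simp: exec_paths_ab_def)
    ultimately have "openin (simplex_top n)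
        {x \<in> standard_simplex n. g' x \<in> {\<gamma> \<in> md_paths (X i). pmap (h i) \<gamma> \<in> U}}"
      using op[OF i] g' unfolding openin_exec_top[OF mdX[OF i]] by blast
    also have "{x \<in> standard_simplex n. g' x \<in> {\<gamma> \<in> md_paths (X i). pmap (h i) \<gamma> \<in> U}} =
        {x \<in> standard_simplex n. g x \<in> U}"
      using g'path eq by auto
    finally show "openin (simplex_top n) {x \<in> standard_simplex n. g x \<in> U}" .
  qed (use U in blast)
  moreover have "U \<subseteq> md_paths Y" if "openin (exec_top Y) U" for U
    using openin_subset[OF that] by (simp add: topspace_exec_top[OF Y])
  ultimately have ope: "openin (exec_top Y) U \<longleftrightarrow> U \<subseteq> md_paths Y \<and>
      (\<forall>i\<in>{\<nu>. \<nu> < \<kappa>}. openin (exec_top (X i)) {\<gamma> \<in> md_paths (X i). pmap (h i) \<gamma> \<in> U})" for U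
    by blast
  have paths: "md_paths Y = (\<Union>i\<in>{\<nu>. \<nu> < \<kappa>}. pmap (h i) ` md_paths (X i))"
    using colimit_paths[OF cocone] by (simp add: lessThan_def)
  show ?thesis
    unfolding top_colimit_def topspace_exec_top[OF Y]
  proof (intro conjI allI ballI impI)
    show "md_paths Y = (\<Union>i\<in>{\<nu>. \<nu> < \<kappa>}. pmap (h i) ` topspace (exec_top (X i)))"
      unfolding paths by (rule SUP_cong) (simp_all add: topspace_exec_top mdX)
  next
    fix i j \<gamma> \<delta>
    assume "i \<in> {\<nu>. \<nu> < \<kappa>}" "j \<in> {\<nu>. \<nu> < \<kappa>}" "\<gamma> \<in> topspace (exec_top (X i))"
      "\<delta> \<in> topspace (exec_top (X j))" "pmap (h i) \<gamma> = pmap (h j) \<delta>"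
    then show "\<exists>k\<in>{\<nu>. \<nu> < \<kappa>}. i \<le> k \<and> j \<le> k \<and> pmap (f i k) \<gamma> = pmap (f j k) \<delta>"
      by (intro eqD) (simp_all add: topspace_exec_top mdX)
  next
    fix U
    show "openin (exec_top Y) U \<longleftrightarrow> U \<subseteq> md_paths Y \<and> (\<forall>i\<in>{\<nu>. \<nu> < \<kappa>}.
        openin (exec_top (X i)) {\<gamma> \<in> topspace (exec_top (X i)). pmap (h i) \<gamma> \<in> U})"
      unfolding ope by (simp add: topspace_exec_top mdX)
  qed
qed

end

end

text \<open>Colimit preservation is expressed at the limit stages. The last clause of
  \<open>top_colimit\<close> is the final topology, which together with the clauses on points gives
  the homeomorphism. Both conjuncts are instances of \<open>exec_paths_colimit\<close>, for \<kappa>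
  a limit stage and for \<kappa> equal to \<open>lam\<close>.\<close>

theorem theorem5p6:
  fixes lam :: "'i::wellorder"
    and X :: "'i \<Rightarrow> 'a mdspace"
    and f :: "'i \<Rightarrow> 'i \<Rightarrow> 'a \<Rightarrow> 'a"
    and Xlam :: "'a mdspace"
    and h :: "'i \<Rightarrow> 'a \<Rightarrow> 'a"
  assumes mds: "\<forall>\<nu><lam. is_mdspace (X \<nu>)"
    and maps: "\<forall>\<mu> \<nu>. \<mu> \<le> \<nu> \<and> \<nu> < lam \<longrightarrow> md_map (X \<mu>) (X \<nu>) (f \<mu> \<nu>)"
    and fid: "\<forall>\<nu><lam. \<forall>x\<in>topspace (md_top (X \<nu>)). f \<nu> \<nu> x = x"
    and fcomp: "\<forall>\<mu> \<nu> \<rho>. \<mu> \<le> \<nu> \<and> \<nu> \<le> \<rho> \<and> \<rho> < lam \<longrightarrow>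
                  (\<forall>x\<in>topspace (md_top (X \<mu>)). f \<mu> \<rho> x = f \<nu> \<rho> (f \<mu> \<nu> x))"
    and zero: "\<forall>\<nu><lam. is_least \<nu> \<longrightarrow> (\<exists>E. X \<nu> = md_set E)"
    and succ: "\<forall>\<nu> \<nu>'. \<nu>' < lam \<and> is_succ \<nu> \<nu>' \<longrightarrow>
                 (\<exists>n g gh. glob_pushout n g (X \<nu>) (X \<nu>') (f \<nu> \<nu>') gh)"
    and limit: "\<forall>\<nu><lam. is_limit \<nu> \<longrightarrow>
                  md_colimit {\<mu>. \<mu> < \<nu>} X f (X \<nu>) (\<lambda>\<mu>. f \<mu> \<nu>)"
    and mdlam: "is_mdspace Xlam"
    and hmaps: "\<forall>\<nu><lam. md_map (X \<nu>) Xlam (h \<nu>)"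
    and hcomp: "\<forall>\<nu> \<rho>. \<nu> \<le> \<rho> \<and> \<rho> < lam \<longrightarrow>
                  (\<forall>x\<in>topspace (md_top (X \<nu>)). h \<nu> x = h \<rho> (f \<nu> \<rho> x))"
    and colim: "md_colimit {\<nu>. \<nu> < lam} X f Xlam h"
  shows "(\<forall>\<nu><lam. is_limit \<nu> \<longrightarrow>
            top_colimit {\<mu>. \<mu> < \<nu>} (\<lambda>\<mu>. exec_top (X \<mu>)) (\<lambda>\<mu> \<rho>. pmap (f \<mu> \<rho>))
              (exec_top (X \<nu>)) (\<lambda>\<mu>. pmap (f \<mu> \<nu>)))
       \<and> top_colimit {\<nu>. \<nu> < lam} (\<lambda>\<nu>. exec_top (X \<nu>)) (\<lambda>\<mu> \<rho>. pmap (f \<mu> \<rho>))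
              (exec_top Xlam) (\<lambda>\<nu>. pmap (h \<nu>))"
proof -
  interpret globular_tower lam X f
  proof
    show "is_mdspace (X \<nu>)" if "\<nu> < lam" for \<nu>
      using mds that by blast
    show "md_map (X \<mu>) (X \<nu>) (f \<mu> \<nu>)" if "\<mu> \<le> \<nu>" "\<nu> < lam" for \<mu> \<nu>
      using maps that by blast
    show "f \<nu> \<nu> x = x" if "\<nu> < lam" "x \<in> topspace (md_top (X \<nu>))" for \<nu> x
      using fid that by blast
    show "f \<mu> \<rho> x = f \<nu> \<rho> (f \<mu> \<nu> x)"
      if "\<mu> \<le> \<nu>" "\<nu> \<le> \<rho>" "\<rho> < lam" "x \<in> topspace (md_top (X \<mu>))" for \<mu> \<nu> \<rho> x
      using fcomp that by blast
    show "\<exists>E. X \<nu> = md_set E" if "\<nu> < lam" "is_least \<nu>" for \<nu>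
      using zero that by blast
    show "\<exists>n g gh. glob_pushout n g (X \<nu>) (X \<nu>') (f \<nu> \<nu>') gh"
      if "\<nu>' < lam" "is_succ \<nu> \<nu>'" for \<nu>' \<nu>
      using succ that by blast
    show "md_colimit {\<mu>. \<mu> < \<nu>} X f (X \<nu>) (\<lambda>\<mu>. f \<mu> \<nu>)" if "\<nu> < lam" "is_limit \<nu>" for \<nu>
      using limit that by blast
  qed
  have "colimit_cocone lam Xlam h"
    unfolding colimit_cocone_def using mdlam hmaps hcomp colim by blast
  then show ?thesis
    using exec_paths_colimit colimit_cocone_limit by blast
qed

end
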